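(* For any $0 < \varepsilon < \frac{1}{2}$, there exists $n_0 \in \mathbb{N}$ such that the following holds. Let $H$ be an $n$-vertex $3$-graph with no isolated vertices, with $n \geq n_0$, $n$ even, and $\delta_2^+(H) \geq \left( \frac{1}{2} + \varepsilon \right)n$. Then $H$ contains a loose Hamiltonian cycle.
   Context: A $3$-graph $H=(V,E)$ is a $3$-uniform hypergraph: $V=V(H)$ is a finite vertex set and $E=E(H) \subseteq \binom{V}{3}$ is a set of $3$-element subsets of $V$, called edges. A vertex is isolated if it lies in no edge of $H$. For a pair $S\in\binom{V}{2}$, its co-degree $d_2(S)$ is the number of edges of $H$ containing $S$. The minimum positive co-degree $\delta_2^+(H)$ is the largest integer $k$ such that for every $S\in\binom{V}{2}$ either $d_2(S)=0$ or $d_2(S)\ge k$; if $H$ has no edges, $\delta_2^+(H)=0$. A ($3$-uniform) loose cycle of length $k$ (for an integer $k\ge 2$) is a $3$-graph on $2k$ distinct vertices $v_1,\dots,v_{2k}$ whose edges are $\{v_{2i+1},v_{2i+2},v_{2i+3}\}$ for $0\le i\le k-1$, with subscripts taken modulo $2k$. A loose Hamiltonian cycle of $H$ is a subhypergraph of $H$ that is a loose cycle whose vertex set is all of $V(H)$. *)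

theory Defs
  imports Complex_Main
begin

record 'a hypergraph =
  verts :: "'a set"
  edges :: "'a set set"

definition three_graph :: "'a hypergraph \<Rightarrow> bool" where
  "three_graph H \<longleftrightarrow> finite (verts H) \<and> edges H \<subseteq> {e. e \<subseteq> verts H \<and> card e = 3}"

definition isolated :: "'a hypergraph \<Rightarrow> 'a \<Rightarrow> bool" where
  "isolated H v \<longleftrightarrow> v \<in> verts H \<and> (\<forall>e\<in>edges H. v \<notin> e)"

definition codegree :: "'a hypergraph \<Rightarrow> 'a set \<Rightarrow> nat" where
  "codegree H S = card {e \<in> edges H. S \<subseteq> e}"

text \<open>If a 3-graph has an edge, some pair has positive co-degree, so the numbers \<open>k\<close> below are
  bounded and \<open>GREATEST\<close> denotes an actual maximum; see \<open>le_min_pos_codegree_iff\<close>.\<close>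

definition min_pos_codegree :: "'a hypergraph \<Rightarrow> nat" where
  "min_pos_codegree H =
     (if edges H = {} then 0
      else GREATEST k. \<forall>S. S \<subseteq> verts H \<and> card S = 2 \<longrightarrow> codegree H S = 0 \<or> k \<le> codegree H S)"

definition subhypergraph :: "'a hypergraph \<Rightarrow> 'a hypergraph \<Rightarrow> bool" where
  "subhypergraph C H \<longleftrightarrow> verts C \<subseteq> verts H \<and> edges C \<subseteq> edges H"

text \<open>The vertices \<open>v\<^sub>1, \<dots>, v\<^sub>2\<^sub>k\<close> are indexed from 0 here: \<open>v j\<close> stands for the vertex with
  subscript \<open>j + 1\<close>. Only the subscript \<open>2i + 3\<close> can exceed \<open>2k\<close>.\<close>

definition loose_cycle :: "nat \<Rightarrow> 'a hypergraph \<Rightarrow> bool" where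
  "loose_cycle k C \<longleftrightarrow> 2 \<le> k \<and>
     (\<exists>v :: nat \<Rightarrow> 'a. inj_on v {..<2 * k} \<and>
        verts C = v ` {..<2 * k} \<and>
        edges C = {{v (2 * i), v (2 * i + 1), v ((2 * i + 2) mod (2 * k))} | i. i < k})"

definition loose_hamiltonian_cycle :: "'a hypergraph \<Rightarrow> 'a hypergraph \<Rightarrow> bool" where
  "loose_hamiltonian_cycle H C \<longleftrightarrow>
     subhypergraph C H \<and> (\<exists>k. loose_cycle k C) \<and> verts C = verts H"

lemma le_min_pos_codegree_iff:
  assumes H: "three_graph H" and ne: "edges H \<noteq> {}"
  shows "k \<le> min_pos_codegree H \<longleftrightarrow>
    (\<forall>S. S \<subseteq> verts H \<and> card S = 2 \<longrightarrow> codegree H S = 0 \<or> k \<le> codegree H S)"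
proof -
  let ?P = "\<lambda>k. \<forall>S. S \<subseteq> verts H \<and> card S = 2 \<longrightarrow> codegree H S = 0 \<or> k \<le> codegree H S"
  obtain e where e: "e \<in> edges H" using ne by blast
  have eV: "e \<subseteq> verts H" "card e = 3" using H e by (auto simp: three_graph_def)
  have "2 \<le> card e" using eV by simp
  then obtain S where S: "S \<subseteq> e" "card S = 2" by (rule obtain_subset_with_card_n)
  have "edges H \<subseteq> Pow (verts H)" "finite (verts H)" using H by (auto simp: three_graph_def)
  then have "finite (edges H)" using finite_subset[OF _ finite_Pow_iff[THEN iffD2]] by blast
  then have "finite {e \<in> edges H. S \<subseteq> e}" by simp
  then have pos: "codegree H S \<noteq> 0" using e S by (auto simp: codegree_def)
  have SV: "S \<subseteq> verts H \<and> card S = 2" using S eV(1) by simp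
  have bound: "j \<le> codegree H S" if "?P j" for j
    using that[rule_format, OF SV] pos by simp
  have P0: "?P 0" by simp
  have G1: "?P (Greatest ?P)" by (rule GreatestI_nat[where P = ?P, OF P0 bound])
  have G2: "j \<le> Greatest ?P" if "?P j" for j
    by (rule Greatest_le_nat[where P = ?P, OF that bound])
  have eq: "min_pos_codegree H = Greatest ?P" using ne by (simp add: min_pos_codegree_def)
  show ?thesis
  proof
    assume "k \<le> min_pos_codegree H"
    then have "k \<le> Greatest ?P" by (simp only: eq)
    show "?P k"
    proof (intro allI impI)
      fix T assume "T \<subseteq> verts H \<and> card T = 2"
      with G1 have "codegree H T = 0 \<or> Greatest ?P \<le> codegree H T" by simp
      with \<open>k \<le> Greatest ?P\<close> show "codegree H T = 0 \<or> k \<le> codegree H T" by linarith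
    qed
  next
    assume "?P k"
    then show "k \<le> min_pos_codegree H" unfolding eq by (rule G2)
  qed
qed

end

theory Submission
  imports Defs "HOL-Real_Asymp.Real_Asymp"
begin

text \<open>
  The edges \<open>{a, b, c}\<close> along a loose path are recorded with the two end vertices \<open>a, c\<close> and the
  middle vertex \<open>b\<close>. Every two vertices are joined by many loose paths with two edges, since
  shadow neighbourhoods and positive co-neighbourhoods all have more than half of the vertices.
  For the same reason every pair \<open>u, v\<close> has \<open>\<Omega>(n\<^sup>3)\<close> absorbers: edges \<open>{a, b, c}\<close> for
  which \<open>a b c\<close> can be replaced by \<open>a u b v c\<close>. A greedy choice gives a short path with linearly many absorbers for
  every pair.

  This path is prolonged by long pieces of bounded length, until few vertices are left.
  Each piece is chosen so that the set \<open>R\<close> of remaining vertices stays typical: every neighbourhood and positive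
  co-neighbourhood covers more than half of \<open>R\<close>. Exponential weights on these sets induce a
  weight on the vertices, and it suffices to find a loose path of nearly average weight. If the
  middle vertices are among the lightest few vertices and the end vertices among the lighter half
  of \<open>R\<close>, with maximal weights \<open>\<alpha>\<close> and \<open>\<mu>\<close>, then \<open>\<alpha> + \<mu>\<close> is at most about twice the average, because
  the lighter half weighs at least about \<open>\<alpha> |R| / 2\<close> and the other half at least \<open>\<mu> |R| / 2\<close>; and
  there are \<open>\<Omega>(|R|\<^sup>3)\<close> such edges because typical sets meet the lighter half.
  Finally the path is closed inside \<open>R\<close> and the rest of \<open>R\<close>, which has even size, is absorbed.
\<close>

section \<open>Loose walks and absorption\<close>

text \<open>Even positions of the list carry the end vertices shared by consecutive edges, odd
  positions the middle vertices. The order within a triple is kept because absorption treats the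
  middle vertex differently.\<close>

fun triples :: "'a list \<Rightarrow> ('a \<times> 'a \<times> 'a) list" where
  "triples (a # b # c # xs) = (a, b, c) # triples (c # xs)"
| "triples xs = []"

text \<open>Distinctness is left out so that a closed cycle can be written as the walk
  \<open>Q @ [hd Q]\<close>. Odd length excludes the empty list and makes the walk stop at an end
  vertex.\<close>

definition loose_walk :: "'a set set \<Rightarrow> 'a list \<Rightarrow> bool" where
  "loose_walk E P \<longleftrightarrow> odd (length P) \<and> (\<forall>(a, b, c) \<in> set (triples P). {a, b, c} \<in> E)"

text \<open>An even prefix puts \<open>c\<close> at an even position, so the list is cut at an end
  vertex and no edge straddles the cut.\<close>

lemma triples_append:
  "even (length xs) \<Longrightarrow> triples (xs @ c # ys) = triples (xs @ [c]) @ triples (c # ys)"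
proof (induction xs rule: induct_list012)
  case (3 x y zs)
  then show ?case by (cases zs) auto
qed auto

lemma triples_subset: "(a, b, c) \<in> set (triples P) \<Longrightarrow> {a, b, c} \<subseteq> set P"
  by (induction P rule: triples.induct) auto

lemma triples_split:
  "(a, b, c) \<in> set (triples P) \<Longrightarrow> \<exists>xs ys. even (length xs) \<and> P = xs @ a # b # c # ys"
proof (induction P rule: triples.induct)
  case (1 x y z zs)
  show ?case
  proof (cases "(a, b, c) = (x, y, z)")
    case True
    show ?thesis
      by (rule exI[of _ "[]"], rule exI[of _ zs]) (use True in simp)
  next
    case False
    then obtain xs ys where *: "even (length xs)" "z # zs = xs @ a # b # c # ys"
      using 1 by auto
    show ?thesis
      by (rule exI[of _ "x # y # xs"], rule exI[of _ ys]) (use * in simp)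
  qed
qed auto

lemma triples_nth:
  "2 * i + 2 < length P \<Longrightarrow> (P ! (2 * i), P ! (2 * i + 1), P ! (2 * i + 2)) \<in> set (triples P)"
proof (induction P arbitrary: i rule: triples.induct)
  case (1 x y z zs)
  show ?case
  proof (cases i)
    case (Suc j)
    then show ?thesis using "1.IH"[of j] "1.prems" by auto
  qed auto
qed auto

text \<open>The two connecting edges leave all old triples intact, so absorbers collected on either
  walk survive.\<close>

lemma loose_walk_join:
  assumes P: "loose_walk E P" and Q: "loose_walk E Q"
    and "{last P, b, z} \<in> E" "{z, b', hd Q} \<in> E"
  shows "loose_walk E (P @ b # z # b' # Q)"
    and "set (triples P) \<union> set (triples Q) \<subseteq> set (triples (P @ b # z # b' # Q))"
proof -
  have ne: "P \<noteq> []" "Q \<noteq> []" using P Q by (auto simp: loose_walk_def)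
  obtain ps p where p: "P = ps @ [p]" using ne by (cases P rule: rev_cases) auto
  obtain q qs where q: "Q = q # qs" using ne by (cases Q) auto
  have ev: "even (length ps)" using P p by (auto simp: loose_walk_def)
  have eq: "triples (P @ b # z # b' # Q) = triples P @ (p, b, z) # (z, b', q) # triples Q"
    using triples_append[OF ev, of p "b # z # b' # q # qs"] p q by simp
  show "loose_walk E (P @ b # z # b' # Q)"
    using assms p q unfolding loose_walk_def eq by auto
  show "set (triples P) \<union> set (triples Q) \<subseteq> set (triples (P @ b # z # b' # Q))"
    unfolding eq by auto
qed

text \<open>The former middle vertex \<open>b\<close> becomes an end vertex and all later positions
  shift by two, so parities are kept. Only the used triple is lost, and the fixed ends keep a
  closing connection valid.\<close>

lemma loose_walk_insert_pair:
  assumes "loose_walk E P" "distinct P" "(a, b, c) \<in> set (triples P)"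
    and "{a, u, b} \<in> E" "{b, v, c} \<in> E" "u \<noteq> v" "u \<notin> set P" "v \<notin> set P"
  obtains P' where "loose_walk E P'" "distinct P'" "set P' = set P \<union> {u, v}"
    "hd P' = hd P" "last P' = last P" "set (triples P) - {(a, b, c)} \<subseteq> set (triples P')"
proof -
  obtain xs ys where ev: "even (length xs)" and P: "P = xs @ a # b # c # ys"
    using triples_split[OF assms(3)] by auto
  let ?P = "xs @ a # u # b # v # c # ys"
  have 1: "triples P = triples (xs @ [a]) @ (a, b, c) # triples (c # ys)"
    using triples_append[OF ev, of a "b # c # ys"] P by simp
  have 2: "triples ?P = triples (xs @ [a]) @ (a, u, b) # (b, v, c) # triples (c # ys)"
    using triples_append[OF ev, of a "u # b # v # c # ys"] by simp
  show ?thesis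
  proof
    show "loose_walk E ?P" using assms 1 2 P by (auto simp: loose_walk_def)
    show "distinct ?P" using assms P by auto
    show "set ?P = set P \<union> {u, v}" using P by auto
    show "hd ?P = hd P" using P by (cases xs) auto
    show "last ?P = last P" using P by simp
    show "set (triples P) - {(a, b, c)} \<subseteq> set (triples ?P)" using 1 2 by auto
  qed
qed

text \<open>\<open>u\<close> and \<open>v\<close> become the middle vertices before and after
  \<open>b\<close>. Membership of \<open>{a, b, c}\<close> lets the absorber lie on the path before
  it is used.\<close>

definition absorbs :: "'a set set \<Rightarrow> 'a \<times> 'a \<Rightarrow> 'a \<times> 'a \<times> 'a \<Rightarrow> bool" where
  "absorbs E = (\<lambda>(u, v) (a, b, c). {a, b, c} \<in> E \<and> {a, u, b} \<in> E \<and> {b, v, c} \<in> E)"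

text \<open>\<open>W\<close> is absorbed pair by pair. Each insertion destroys one triple of the
  path, so every other pair loses at most one absorber, and \<open>m\<close> absorbers per pair
  suffice for \<open>m\<close> insertions. Absorbers may share end vertices.\<close>

lemma absorb_set:
  assumes "loose_walk E P" "distinct P" "T \<subseteq> set (triples P)" "finite W" "card W = 2 * m"
    and "W \<inter> set P = {}"
    and "\<And>u v. u \<in> W \<Longrightarrow> v \<in> W \<Longrightarrow> u \<noteq> v \<Longrightarrow> m \<le> card {t \<in> T. absorbs E (u, v) t}"
  shows "\<exists>P'. loose_walk E P' \<and> distinct P' \<and> set P' = set P \<union> W \<and> hd P' = hd P \<and> last P' = last P"
  using assms
proof (induction m arbitrary: P T W)
  case 0
  then show ?case by auto
next
  case (Suc m)
  have finT: "finite T" using Suc.prems(3) finite_subset by blast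
  obtain u v where uv: "u \<in> W" "v \<in> W" "u \<noteq> v"
    using Suc.prems(4,5) card_le_Suc0_iff_eq[of W] by fastforce
  have "Suc m \<le> card {t \<in> T. absorbs E (u, v) t}" using Suc.prems(7) uv by blast
  then have "{t \<in> T. absorbs E (u, v) t} \<noteq> {}" by force
  then obtain a b c where t: "(a, b, c) \<in> T" "absorbs E (u, v) (a, b, c)" by auto
  obtain P1 where P1: "loose_walk E P1" "distinct P1" "set P1 = set P \<union> {u, v}"
    "hd P1 = hd P" "last P1 = last P" "set (triples P) - {(a, b, c)} \<subseteq> set (triples P1)"
    using loose_walk_insert_pair[OF Suc.prems(1,2), of a b c u v] t uv Suc.prems(3,6)
    by (auto simp: absorbs_def)
  have "\<exists>P'. loose_walk E P' \<and> distinct P' \<and> set P' = set P1 \<union> (W - {u, v}) \<and> hd P' = hd P1 \<and> last P' = last P1"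
  proof (rule Suc.IH[OF P1(1,2)])
    show "T - {(a, b, c)} \<subseteq> set (triples P1)" using P1(6) Suc.prems(3) by auto
    show "finite (W - {u, v})" using Suc.prems(4) by simp
    show "card (W - {u, v}) = 2 * m" using Suc.prems(4,5) uv by (simp add: card_Diff_subset)
    show "(W - {u, v}) \<inter> set P1 = {}" using Suc.prems(6) P1(3) by auto
    fix x y assume xy: "x \<in> W - {u, v}" "y \<in> W - {u, v}" "x \<noteq> y"
    have "Suc m \<le> card {t \<in> T. absorbs E (x, y) t}" using Suc.prems(7) xy by blast
    also have "\<dots> \<le> card (insert (a, b, c) {t \<in> T - {(a, b, c)}. absorbs E (x, y) t})"
      using finT by (intro card_mono) auto
    also have "\<dots> \<le> Suc (card {t \<in> T - {(a, b, c)}. absorbs E (x, y) t})"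
      using finT by (simp add: card_insert_if)
    finally show "m \<le> card {t \<in> T - {(a, b, c)}. absorbs E (x, y) t}" by simp
  qed
  moreover have "set P1 \<union> (W - {u, v}) = set P \<union> W" using P1(3) uv by auto
  ultimately show ?case using P1(4,5) by auto
qed

lemma loose_cycle_of_walk:
  assumes H: "edges H = E" "verts H = set Q" and Q: "distinct Q" "length Q = 2 * k" "2 \<le> k"
    and walk: "loose_walk E (Q @ [hd Q])"
  shows "\<exists>C. loose_hamiltonian_cycle H C"
proof -
  define v where "v = (\<lambda>j. Q ! j)"
  define C where "C = \<lparr>verts = set Q,
    edges = {{v (2 * i), v (2 * i + 1), v ((2 * i + 2) mod (2 * k))} | i. i < k}\<rparr>"
  have "{v (2 * i), v (2 * i + 1), v ((2 * i + 2) mod (2 * k))} \<in> E" if i: "i < k" for i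
  proof -
    let ?R = "Q @ [hd Q]"
    have "{?R ! (2 * i), ?R ! (2 * i + 1), ?R ! (2 * i + 2)} \<in> E"
      using triples_nth[of i ?R] walk i Q(2) unfolding loose_walk_def by fastforce
    moreover have "?R ! (2 * i) = v (2 * i)" "?R ! (2 * i + 1) = v (2 * i + 1)"
      using i Q(2) by (auto simp: v_def nth_append)
    \<comment> \<open>Only the last edge wraps around: position \<open>2 * k\<close> of the closed
      walk holds the repeated \<open>hd Q\<close>, which is \<open>v 0\<close>.\<close>
    moreover have "?R ! (2 * i + 2) = v ((2 * i + 2) mod (2 * k))"
    proof (cases "2 * i + 2 = 2 * k")
      case True
      then have "?R ! (2 * i + 2) = hd Q" using Q(2) by (simp add: nth_append)
      also have "hd Q = v 0" using Q by (cases Q) (auto simp: v_def)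
      finally show ?thesis using True by simp
    next
      case False
      then have "2 * i + 2 < 2 * k" using i by linarith
      then show ?thesis using Q(2) by (simp add: v_def nth_append)
    qed
    ultimately show ?thesis by simp
  qed
  then have "edges C \<subseteq> E" unfolding C_def by auto
  moreover have "loose_cycle k C"
  proof -
    have "inj_on v {..<2 * k}"
      using Q by (auto simp: inj_on_def v_def nth_eq_iff_index_eq)
    moreover have "verts C = v ` {..<2 * k}"
      using Q(2) by (auto simp: C_def v_def set_conv_nth)
    ultimately show ?thesis
      unfolding loose_cycle_def using Q(3) by (auto simp: C_def intro!: exI[of _ v])
  qed
  ultimately show ?thesis
    unfolding loose_hamiltonian_cycle_def subhypergraph_def using H by (intro exI[of _ C]) (auto simp: C_def)
qed

section \<open>Typical sets and connections\<close>

locale finite_three_graph =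
  fixes V :: "'a set" and E :: "'a set set"
  assumes finite_V: "finite V" and edge: "e \<in> E \<Longrightarrow> e \<subseteq> V \<and> card e = 3"
begin

lemma edge_triple:
  assumes "{x, y, z} \<in> E"
  shows "x \<in> V" "y \<in> V" "z \<in> V" "x \<noteq> y" "x \<noteq> z" "y \<noteq> z"
proof -
  have *: "card {x, y, z} = 3" "{x, y, z} \<subseteq> V" using edge[OF assms] by auto
  then show "x \<in> V" "y \<in> V" "z \<in> V" by auto
  show "x \<noteq> y" "x \<noteq> z" "y \<noteq> z" using *(1) by (auto simp: card_insert_if split: if_splits)
qed

definition nbr :: "'a \<Rightarrow> 'a set" where
  "nbr x = {y. \<exists>z. {x, y, z} \<in> E}"

definition conbr :: "'a \<Rightarrow> 'a \<Rightarrow> 'a set" where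
  "conbr x y = {z. {x, y, z} \<in> E}"

text \<open>These are the sets whose density in the remaining vertices must stay above one half.
  Empty co-neighbourhoods are excluded since only positive co-degrees are bounded below.\<close>

definition tests :: "'a set set" where
  "tests = nbr ` V \<union> {conbr x y | x y. conbr x y \<noteq> {}}"

definition typical :: "real \<Rightarrow> 'a set \<Rightarrow> bool" where
  "typical \<rho> R \<longleftrightarrow> (\<forall>S\<in>tests. (1 / 2 + \<rho>) * card R \<le> card (S \<inter> R))"

text \<open>The polynomial bound is what lets an exponentially small weight per test give a total
  weight below 1.\<close>

lemma finite_tests: "finite tests" and card_tests: "card tests \<le> card V + (card V)\<^sup>2"
proof -
  have sub: "tests \<subseteq> nbr ` V \<union> (\<lambda>(x, y). conbr x y) ` (V \<times> V)"
    unfolding tests_def using edge_triple(1,2) by (auto simp: conbr_def)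
  have fin: "finite (nbr ` V \<union> (\<lambda>(x, y). conbr x y) ` (V \<times> V))"
    using finite_V by simp
  show "finite tests" using finite_subset[OF sub fin] .
  have "card tests \<le> card (nbr ` V) + card ((\<lambda>(x, y). conbr x y) ` (V \<times> V))"
    using card_mono[OF fin sub] card_Un_le order_trans by blast
  also have "\<dots> \<le> card V + card (V \<times> V)"
    using finite_V by (intro add_mono card_image_le) auto
  finally show "card tests \<le> card V + (card V)\<^sup>2"
    by (simp add: card_cartesian_product power2_eq_square)
qed

lemma typical_nbr:
  "typical \<rho> R \<Longrightarrow> x \<in> V \<Longrightarrow> (1 / 2 + \<rho>) * card R \<le> card (nbr x \<inter> R)"
  by (auto simp: typical_def tests_def)

lemma typical_conbr:
  "typical \<rho> R \<Longrightarrow> y \<in> nbr x \<Longrightarrow> (1 / 2 + \<rho>) * card R \<le> card (conbr x y \<inter> R)"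
  unfolding typical_def tests_def by (auto simp: nbr_def conbr_def)

text \<open>By inclusion-exclusion, since the union of the two traces still fits into
  \<open>R\<close>.\<close>

lemma card_Int_ge:
  fixes \<rho> :: real
  assumes "finite R" "(1 / 2 + \<rho>) * card R \<le> card (S \<inter> R)" "(1 / 2 + \<rho>) * card R \<le> card (T \<inter> R)"
  shows "2 * \<rho> * card R \<le> card (S \<inter> T \<inter> R)"
proof -
  have "(S \<inter> R) \<inter> (T \<inter> R) = S \<inter> T \<inter> R" by auto
  then have "card ((S \<inter> R) \<union> (T \<inter> R)) + card (S \<inter> T \<inter> R) = card (S \<inter> R) + card (T \<inter> R)"
    using card_Un_Int[of "S \<inter> R" "T \<inter> R"] assms(1) by simp
  moreover have "card ((S \<inter> R) \<union> (T \<inter> R)) \<le> card R" using assms(1) by (intro card_mono) auto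
  ultimately have "real (card (S \<inter> R)) + real (card (T \<inter> R)) \<le> real (card R) + real (card (S \<inter> T \<inter> R))"
    by linarith
  then show ?thesis using assms(2,3) by (simp add: algebra_simps)
qed

lemma card_diff_ge: "finite F \<Longrightarrow> real (card A) - real (card F) \<le> real (card (A - F))"
  using diff_card_le_card_Diff[of F A] by linarith

lemma nonempty_diff: "finite F \<Longrightarrow> card F < card A \<Longrightarrow> \<exists>x. x \<in> A - F"
  by (metis card_mono equals0I Diff_eq_empty_iff leD)

text \<open>The vertex \<open>z\<close> is taken from the common neighbourhood of \<open>x\<close>
  and \<open>y\<close>, so both pairs \<open>x, z\<close> and \<open>y, z\<close> have positive
  co-degree; \<open>b\<close> and \<open>b'\<close> then come from their co-neighbourhoods. The
  slack 2 pays for avoiding \<open>z\<close> and \<open>b\<close>.\<close>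

lemma connect:
  assumes tp: "typical \<rho> R" and R: "R \<subseteq> V" and \<rho>: "0 < \<rho>" "\<rho> \<le> 1 / 2" and xy: "x \<in> V" "y \<in> V"
    and F: "finite F" "x \<in> F" "y \<in> F" "real (card F) + 2 < 2 * \<rho> * card R"
  obtains b z b' where "{x, b, z} \<in> E" "{z, b', y} \<in> E" "distinct [b, z, b']"
    "{b, z, b'} \<subseteq> R - F"
proof -
  have finR: "finite R" using R finite_V finite_subset by blast
  \<comment> \<open>Since \<open>\<rho> \<le> 1 / 2\<close>, the size bound on \<open>F\<close> also
    leaves room in each single co-neighbourhood.\<close>
  have le: "2 * \<rho> * card R \<le> (1 / 2 + \<rho>) * card R"
    using \<rho>(2) by (intro mult_right_mono) auto
  have "2 * \<rho> * card R \<le> card (nbr x \<inter> nbr y \<inter> R)"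
    using card_Int_ge[OF finR typical_nbr[OF tp xy(1)] typical_nbr[OF tp xy(2)]] .
  then have "card F < card (nbr x \<inter> nbr y \<inter> R)" using F by linarith
  then obtain z where z: "z \<in> nbr x" "z \<in> nbr y" "z \<in> R" "z \<notin> F"
    using nonempty_diff[OF F(1)] by blast
  have "card (insert z F) < card (conbr x z \<inter> R)"
    using typical_conbr[OF tp z(1)] F le z by simp
  then obtain b where b: "b \<in> conbr x z" "b \<in> R" "b \<notin> insert z F"
    using nonempty_diff[of "insert z F"] F(1) by blast
  have "card (insert b (insert z F)) < card (conbr y z \<inter> R)"
    using typical_conbr[OF tp z(2)] F le z b by simp
  then obtain b' where b': "b' \<in> conbr y z" "b' \<in> R" "b' \<notin> insert b (insert z F)"
    using nonempty_diff[of "insert b (insert z F)"] F(1) by blast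
  show ?thesis
  proof
    show "{x, b, z} \<in> E" using b(1) by (simp add: conbr_def insert_commute)
    show "{z, b', y} \<in> E" using b'(1) by (simp add: conbr_def insert_commute)
    show "distinct [b, z, b']" using b b' by auto
    show "{b, z, b'} \<subseteq> R - F" using b b' z by auto
  qed
qed

section \<open>Counting absorbers\<close>

lemma card_Sigma_ge:
  fixes k :: real
  assumes "finite A" "\<And>x. x \<in> A \<Longrightarrow> finite (B x)" "\<And>x. x \<in> A \<Longrightarrow> k \<le> card (B x)"
  shows "card A * k \<le> card (Sigma A B)"
proof -
  have "card A * k \<le> (\<Sum>x\<in>A. real (card (B x)))"
    using sum_mono[of A "\<lambda>_. k" "\<lambda>x. real (card (B x))"] assms by simp
  then show ?thesis using assms by (simp add: card_SigmaI)
qed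

text \<open>Choose \<open>b\<close> in the common neighbourhood of \<open>u\<close> and
  \<open>v\<close>, then \<open>a\<close> completing \<open>u, b\<close>, then \<open>c\<close>
  completing both \<open>a, b\<close> and \<open>v, b\<close>. The edge through
  \<open>a, b, u\<close> makes the pair \<open>a, b\<close> positive. After avoiding
  \<open>F\<close> there remain at least \<open>\<epsilon> n\<close>, \<open>n / 2\<close> and
  \<open>\<epsilon> n\<close> choices.\<close>

lemma absorbers_ge:
  fixes \<epsilon> :: real
  assumes tp: "typical \<epsilon> V" and \<epsilon>: "0 < \<epsilon>" and uv: "u \<in> V" "v \<in> V"
    and F: "F \<subseteq> V" "card F \<le> \<epsilon> * card V"
  shows "\<epsilon>\<^sup>2 / 2 * (card V) ^ 3 \<le> card {t \<in> (V - F) \<times> (V - F) \<times> (V - F). absorbs E (u, v) t}"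
proof -
  let ?n = "card V"
  have finF: "finite F" using F finite_V finite_subset by blast
  define B where "B = nbr u \<inter> nbr v \<inter> V - F"
  define A where "A = (\<lambda>b. conbr u b \<inter> V - F)"
  define C where "C = (\<lambda>b a. conbr a b \<inter> conbr v b \<inter> V - F)"
  have fin: "finite B" "\<And>b. finite (A b)" "\<And>b a. finite (C b a)"
    using finite_V by (auto simp: A_def B_def C_def)
  have B: "\<epsilon> * ?n \<le> card B"
    using card_Int_ge[OF finite_V typical_nbr[OF tp uv(1)] typical_nbr[OF tp uv(2)]] F(2)
      card_diff_ge[OF finF, of "nbr u \<inter> nbr v \<inter> V"] unfolding B_def by linarith
  have A: "1 / 2 * real ?n \<le> card (A b)" if "b \<in> B" for b
    using that typical_conbr[OF tp, of b u] card_diff_ge[OF finF, of "conbr u b \<inter> V"] F(2)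
    by (auto simp: A_def B_def algebra_simps)
  have C: "\<epsilon> * ?n \<le> card (C b a)" if "b \<in> B" "a \<in> A b" for a b
  proof -
    have "{a, b, u} \<in> E" using that by (simp add: A_def conbr_def insert_commute)
    then have "b \<in> nbr a" by (auto simp: nbr_def)
    moreover have "b \<in> nbr v" using that by (simp add: B_def)
    ultimately show ?thesis
      using card_Int_ge[OF finite_V typical_conbr[OF tp] typical_conbr[OF tp], of b a b v] F(2)
        card_diff_ge[OF finF, of "conbr a b \<inter> conbr v b \<inter> V"] unfolding C_def by linarith
  qed
  let ?S = "Sigma B (\<lambda>b. Sigma (A b) (C b))"
  have "\<epsilon>\<^sup>2 / 2 * real ?n ^ 3 = (\<epsilon> * ?n) * ((1 / 2 * real ?n) * (\<epsilon> * ?n))"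
    by (simp add: power2_eq_square power3_eq_cube)
  also have "\<dots> \<le> card B * ((1 / 2 * real ?n) * (\<epsilon> * ?n))"
    using B \<epsilon> by (intro mult_right_mono) auto
  also have "\<dots> \<le> card ?S"
  proof (rule card_Sigma_ge)
    fix b assume b: "b \<in> B"
    have "(1 / 2 * real ?n) * (\<epsilon> * ?n) \<le> card (A b) * (\<epsilon> * ?n)"
      using A[OF b] \<epsilon> by (intro mult_right_mono) auto
    also have "\<dots> \<le> card (Sigma (A b) (C b))"
      by (rule card_Sigma_ge) (use fin C b in auto)
    finally show "(1 / 2 * real ?n) * (\<epsilon> * ?n) \<le> card (Sigma (A b) (C b))" .
  qed (use fin in auto)
  \<comment> \<open>The choices were made in the order \<open>b, a, c\<close>; this restores the
    order of the triple.\<close>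
  also have "card ?S = card ((\<lambda>(b, a, c). (a, b, c)) ` ?S)"
    by (intro card_image[symmetric]) (auto simp: inj_on_def)
  also have "real \<dots> \<le> card {t \<in> (V - F) \<times> (V - F) \<times> (V - F). absorbs E (u, v) t}"
    using finite_V by (intro of_nat_mono card_mono)
      (auto simp: A_def B_def C_def conbr_def absorbs_def insert_commute)
  finally show ?thesis by simp
qed

end

section \<open>The absorbing path\<close>

lemma exists_ge_average:
  fixes f :: "'b \<Rightarrow> real"
  assumes "finite Y" "real (card Y) \<le> N" "0 < N * c" "0 \<le> c" "N * c \<le> sum f Y"
  shows "\<exists>y\<in>Y. c \<le> f y"
proof (rule ccontr)
  assume "\<not> ?thesis"
  then have less: "\<And>y. y \<in> Y \<Longrightarrow> f y < c" by auto
  have "Y \<noteq> {}" using assms(3,5) by auto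
  then have "sum f Y < (\<Sum>y\<in>Y. c)" using assms(1) less by (intro sum_strict_mono) auto
  also have "\<dots> \<le> N * c" using assms by (simp add: mult_right_mono)
  finally show False using assms by simp
qed

context finite_three_graph
begin

text \<open>Potential of the greedy choice; some absorber always serves a constant proportion of it.\<close>

definition deficit :: "('a \<times> 'a \<times> 'a) set \<Rightarrow> real" where
  "deficit T = (\<Sum>p\<in>V \<times> V. (1 / 2) ^ card {t \<in> T. absorbs E p t})"

text \<open>A new absorber halves the weight of every pair it absorbs and leaves the other weights
  alone.\<close>

lemma deficit_insert:
  assumes "finite T" "y \<notin> T"
  shows "deficit (insert y T) =
    deficit T - 1 / 2 * (\<Sum>p\<in>{p \<in> V \<times> V. absorbs E p y}. (1 / 2) ^ card {t \<in> T. absorbs E p t})"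
proof -
  let ?w = "\<lambda>p. (1 / 2 :: real) ^ card {t \<in> T. absorbs E p t}"
  have eq: "(1 / 2 :: real) ^ card {t \<in> insert y T. absorbs E p t} =
      ?w p - 1 / 2 * (if absorbs E p y then ?w p else 0)" for p
  proof (cases "absorbs E p y")
    case True
    then have "{t \<in> insert y T. absorbs E p t} = insert y {t \<in> T. absorbs E p t}" by auto
    then have "card {t \<in> insert y T. absorbs E p t} = Suc (card {t \<in> T. absorbs E p t})"
      using assms by simp
    then show ?thesis using True by (simp add: field_simps)
  next
    case False
    then have "{t \<in> insert y T. absorbs E p t} = {t \<in> T. absorbs E p t}" by auto
    then show ?thesis using False by simp
  qed
  show ?thesis
    unfolding deficit_def eq sum_subtractf sum_distrib_left[symmetric]
    using finite_V by (subst sum.inter_filter) auto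
qed

text \<open>Weighted double counting: every pair is served by at least a proportion
  \<open>\<epsilon>\<^sup>2 / 2\<close> of all \<open>n ^ 3\<close> triples, so the average triple
  serves at least this proportion of the total weight.\<close>

lemma exists_good_absorber:
  fixes \<epsilon> :: real
  assumes tp: "typical \<epsilon> V" and \<epsilon>: "0 < \<epsilon>" and V: "V \<noteq> {}"
    and F: "F \<subseteq> V" "card F \<le> \<epsilon> * card V"
  shows "\<exists>y\<in>(V - F) \<times> (V - F) \<times> (V - F). \<epsilon>\<^sup>2 / 2 * deficit T
    \<le> (\<Sum>p\<in>{p \<in> V \<times> V. absorbs E p y}. (1 / 2) ^ card {t \<in> T. absorbs E p t})"
proof (rule exists_ge_average[where N = "real (card V) ^ 3"])
  let ?Y = "(V - F) \<times> (V - F) \<times> (V - F)"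
  let ?w = "\<lambda>p. (1 / 2 :: real) ^ card {t \<in> T. absorbs E p t}"
  show finY: "finite ?Y" using finite_V by simp
  have "card (V - F) \<le> card V" using finite_V by (intro card_mono) auto
  then have "card ?Y \<le> card V * (card V * card V)"
    by (simp add: card_cartesian_product mult_le_mono)
  then show "real (card ?Y) \<le> real (card V) ^ 3"
    by (metis of_nat_le_iff of_nat_power power3_eq_cube mult.assoc)
  have pos: "0 < deficit T"
    unfolding deficit_def using finite_V V by (intro sum_pos) auto
  moreover have "0 < card V" using V finite_V by (simp add: card_gt_0_iff)
  ultimately show "0 < real (card V) ^ 3 * (\<epsilon>\<^sup>2 / 2 * deficit T)" "0 \<le> \<epsilon>\<^sup>2 / 2 * deficit T"
    using \<epsilon> by simp_all
  have "real (card V) ^ 3 * (\<epsilon>\<^sup>2 / 2 * deficit T) = (\<Sum>p\<in>V \<times> V. \<epsilon>\<^sup>2 / 2 * real (card V) ^ 3 * ?w p)"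
    unfolding deficit_def sum_distrib_left[symmetric] by simp
  also have "\<dots> \<le> (\<Sum>p\<in>V \<times> V. card {t \<in> ?Y. absorbs E p t} * ?w p)"
  proof (intro sum_mono mult_right_mono)
    fix p assume "p \<in> V \<times> V"
    then show "\<epsilon>\<^sup>2 / 2 * real (card V) ^ 3 \<le> card {t \<in> ?Y. absorbs E p t}"
      using absorbers_ge[OF tp \<epsilon> _ _ F] by (cases p) auto
  qed auto
  also have "\<dots> = (\<Sum>p\<in>V \<times> V. \<Sum>y\<in>?Y. if absorbs E p y then ?w p else 0)"
    using finY by (simp add: sum.inter_filter[symmetric] cong: sum.cong)
  also have "\<dots> = (\<Sum>y\<in>?Y. \<Sum>p\<in>V \<times> V. if absorbs E p y then ?w p else 0)"
    by (rule sum.swap)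
  also have "\<dots> = (\<Sum>y\<in>?Y. \<Sum>p\<in>{p \<in> V \<times> V. absorbs E p y}. ?w p)"
    using finite_V by (intro sum.cong refl sum.inter_filter[symmetric]) auto
  finally show "real (card V) ^ 3 * (\<epsilon>\<^sup>2 / 2 * deficit T)
    \<le> (\<Sum>y\<in>?Y. \<Sum>p\<in>{p \<in> V \<times> V. absorbs E p y}. ?w p)" .
qed

text \<open>Each round appends six vertices, three for the connection and three for the absorber,
  and halves the weight of a proportion \<open>\<epsilon>\<^sup>2 / 2\<close> of the deficit.
  Initially all \<open>n\<^sup>2\<close> ordered pairs have weight 1.\<close>

lemma absorbing_path_deficit:
  fixes \<epsilon> :: real
  assumes tp: "typical \<epsilon> V" and \<epsilon>: "0 < \<epsilon>" "\<epsilon> \<le> 1 / 2" and V: "V \<noteq> {}"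
  shows "real (6 * s + 1) \<le> \<epsilon> * card V \<Longrightarrow> \<exists>P T. loose_walk E P \<and> distinct P \<and> set P \<subseteq> V \<and>
    length P = 6 * s + 1 \<and> T \<subseteq> set (triples P) \<and> deficit T \<le> (1 - \<epsilon>\<^sup>2 / 4) ^ s * (real (card V))\<^sup>2"
proof (induction s)
  case 0
  obtain x where "x \<in> V" using V by auto
  then show ?case
    by (intro exI[of _ "[x]"] exI[of _ "{}"])
      (auto simp: loose_walk_def deficit_def card_cartesian_product power2_eq_square)
next
  case (Suc s)
  then obtain P T where P: "loose_walk E P" "distinct P" "set P \<subseteq> V" "length P = 6 * s + 1"
    and T: "T \<subseteq> set (triples P)" "deficit T \<le> (1 - \<epsilon>\<^sup>2 / 4) ^ s * (real (card V))\<^sup>2" by auto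
  have cardP: "card (set P) = 6 * s + 1" using P distinct_card by metis
  have finT: "finite T" using T(1) finite_subset by blast
  obtain y where y: "y \<in> (V - set P) \<times> (V - set P) \<times> (V - set P)"
    and yge: "\<epsilon>\<^sup>2 / 2 * deficit T
    \<le> (\<Sum>p\<in>{p \<in> V \<times> V. absorbs E p y}. (1 / 2) ^ card {t \<in> T. absorbs E p t})"
    using exists_good_absorber[OF tp \<epsilon>(1) V P(3), of T] Suc.prems cardP by auto
  obtain a b c where abc: "y = (a, b, c)" by (cases y) auto
  have in_V: "a \<in> V - set P" "b \<in> V - set P" "c \<in> V - set P" using y abc by auto
  have pos: "0 < \<epsilon>\<^sup>2 / 2 * deficit T"
    unfolding deficit_def using finite_V V \<epsilon> by (intro mult_pos_pos sum_pos) auto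
  \<comment> \<open>The triple was taken from all triples outside the path. That it is an edge
    follows from its serving a positive weight, hence some pair.\<close>
  have "{p \<in> V \<times> V. absorbs E p y} \<noteq> {}" using pos yge by (intro notI) simp
  then have edge_y: "{a, b, c} \<in> E" by (auto simp: absorbs_def abc)
  then have dist_y: "distinct [a, b, c]" using edge_triple(4-6)[of a b c] by auto
  have ne: "P \<noteq> []" using P by auto
  let ?F = "set P \<union> {a, b, c}"
  have "card ?F \<le> 6 * s + 4"
    using cardP card_Un_le[of "set P" "{a, b, c}"] dist_y by simp
  then have "real (card ?F) \<le> 6 * s + 4" by (metis of_nat_le_iff)
  then have cF: "real (card ?F) + 2 < 2 * \<epsilon> * card V" using Suc.prems by simp
  obtain d z e where con: "{last P, d, z} \<in> E" "{z, e, a} \<in> E" "distinct [d, z, e]"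
    "{d, z, e} \<subseteq> V - ?F"
    by (rule connect[OF tp subset_refl \<epsilon> _ _ _ _ _ cF, of "last P" a]) (use P(3) ne in_V in auto)
  let ?P = "P @ d # z # e # [a, b, c]"
  have walk: "loose_walk E [a, b, c]" using edge_y by (simp add: loose_walk_def)
  have "loose_walk E ?P" and tri: "set (triples P) \<union> set (triples [a, b, c]) \<subseteq> set (triples ?P)"
    using loose_walk_join[OF P(1) walk] con(1,2) by auto
  moreover have "distinct ?P" using P(2) con(3,4) dist_y in_V by auto
  moreover have "set ?P \<subseteq> V" using P(3) con(4) in_V by auto
  moreover have "length ?P = 6 * Suc s + 1" using P(4) by simp
  moreover have "insert y T \<subseteq> set (triples ?P)" using T(1) tri abc by auto
  moreover have "deficit (insert y T) \<le> (1 - \<epsilon>\<^sup>2 / 4) ^ Suc s * (real (card V))\<^sup>2"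
  proof -
    have "y \<notin> T" using T(1) triples_subset[of a b c P] in_V abc by auto
    from deficit_insert[OF finT this]
    have "deficit (insert y T) \<le> deficit T - 1 / 2 * (\<epsilon>\<^sup>2 / 2 * deficit T)"
      using yge by linarith
    also have "\<dots> = (1 - \<epsilon>\<^sup>2 / 4) * deficit T" by (simp add: algebra_simps)
    also have "\<dots> \<le> (1 - \<epsilon>\<^sup>2 / 4) * ((1 - \<epsilon>\<^sup>2 / 4) ^ s * (real (card V))\<^sup>2)"
    proof (rule mult_left_mono[OF T(2)])
      have "\<epsilon>\<^sup>2 \<le> 1" using \<epsilon> by (simp add: power_le_one)
      then show "0 \<le> 1 - \<epsilon>\<^sup>2 / 4" by simp
    qed
    finally show ?thesis by (simp add: mult.assoc)
  qed
  ultimately show ?case by blast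
qed

text \<open>After \<open>K * k\<close> rounds the deficit is at most \<open>(1 / 4) ^ k\<close>
  times \<open>n\<^sup>2\<close>, hence below \<open>(1 / 2) ^ k\<close>, while a single pair with
  fewer than \<open>k\<close> absorbers would contribute at least that much.\<close>

lemma absorbing_path:
  fixes \<epsilon> :: real
  assumes tp: "typical \<epsilon> V" and \<epsilon>: "0 < \<epsilon>" "\<epsilon> \<le> 1 / 2" and V: "V \<noteq> {}"
    and K: "(1 - \<epsilon>\<^sup>2 / 4) ^ K \<le> 1 / 4" and k: "(real (card V))\<^sup>2 < 2 ^ k"
    and small: "real (6 * (K * k) + 1) \<le> \<epsilon> * card V"
  obtains P T where "loose_walk E P" "distinct P" "set P \<subseteq> V" "length P = 6 * (K * k) + 1"
    "T \<subseteq> set (triples P)"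
    "\<And>u v. u \<in> V \<Longrightarrow> v \<in> V \<Longrightarrow> k \<le> card {t \<in> T. absorbs E (u, v) t}"
proof -
  obtain P T where P: "loose_walk E P" "distinct P" "set P \<subseteq> V" "length P = 6 * (K * k) + 1"
    "T \<subseteq> set (triples P)"
    and def: "deficit T \<le> (1 - \<epsilon>\<^sup>2 / 4) ^ (K * k) * (real (card V))\<^sup>2"
    using absorbing_path_deficit[OF tp \<epsilon> V small] by blast
  have "k \<le> card {t \<in> T. absorbs E (u, v) t}" if uv: "u \<in> V" "v \<in> V" for u v
  proof (rule ccontr)
    assume "\<not> ?thesis"
    then have "(1 / 2 :: real) ^ k \<le> (1 / 2) ^ card {t \<in> T. absorbs E (u, v) t}"
      by (intro power_decreasing) auto
    also have "\<dots> \<le> deficit T"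
      unfolding deficit_def using uv finite_V
      by (intro member_le_sum[of "(u, v)" "V \<times> V" "\<lambda>p. (1 / 2 :: real) ^ card {t \<in> T. absorbs E p t}"]) auto
    also have "\<dots> \<le> ((1 - \<epsilon>\<^sup>2 / 4) ^ K) ^ k * (real (card V))\<^sup>2" using def by (simp add: power_mult)
    also have "\<dots> \<le> (1 / 4) ^ k * (real (card V))\<^sup>2"
    proof (intro mult_right_mono power_mono K)
      have "\<epsilon>\<^sup>2 \<le> 1" using \<epsilon> by (simp add: power_le_one)
      then show "0 \<le> (1 - \<epsilon>\<^sup>2 / 4) ^ K" by simp
    qed auto
    also have "\<dots> < (1 / 4) ^ k * 2 ^ k" using k by simp
    also have "\<dots> = (1 / 2 :: real) ^ k" by (simp add: power_mult_distrib[symmetric])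
    finally show False by simp
  qed
  then show ?thesis using P that by blast
qed

end

section \<open>Loose walks of almost average weight\<close>

text \<open>The \<open>k\<close> lightest elements, with a threshold separating them from the rest.
  The threshold is an attained weight, so that bounds on \<open>w\<close> carry over to it.\<close>

lemma threshold_subset:
  fixes w :: "'b \<Rightarrow> real"
  assumes "finite R"
  shows "k < card R \<Longrightarrow> \<exists>U \<alpha>. U \<subseteq> R \<and> card U = k \<and> \<alpha> \<in> w ` R \<and> (\<forall>u\<in>U. w u \<le> \<alpha>) \<and> (\<forall>v\<in>R - U. \<alpha> \<le> w v)"
proof (induction k)
  case 0
  then have "R \<noteq> {}" by auto
  then have "Min (w ` R) \<in> w ` R" "\<forall>v\<in>R. Min (w ` R) \<le> w v" using assms by auto
  then show ?case by (intro exI[of _ "{}"] exI[of _ "Min (w ` R)"]) auto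
next
  case (Suc k)
  then obtain U \<alpha> where U: "U \<subseteq> R" "card U = k" "\<forall>u\<in>U. w u \<le> \<alpha>" "\<forall>v\<in>R - U. \<alpha> \<le> w v" by auto
  have finU: "finite U" using U(1) assms finite_subset by blast
  have "R - U \<noteq> {}" using U Suc.prems by (metis Diff_eq_empty_iff Suc_lessD card_mono finU not_less)
  then obtain v where v: "v \<in> R - U" "\<forall>x\<in>R - U. w v \<le> w x"
    using ex_is_arg_min_if_finite[of "R - U" w] assms by (auto simp: is_arg_min_def not_less)
  have "insert v U \<subseteq> R" "card (insert v U) = Suc k" using U v finU by auto
  moreover have "\<forall>u\<in>insert v U. w u \<le> w v" using U v by (auto intro: order_trans)
  moreover have "\<forall>x\<in>R - insert v U. w v \<le> w x" using v by auto
  moreover have "w v \<in> w ` R" using v by auto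
  ultimately show ?case by blast
qed

context finite_three_graph
begin

section \<open>Walks with middle vertices in one set and end vertices in another\<close>

definition extensions :: "'a set \<Rightarrow> 'a set \<Rightarrow> 'a \<Rightarrow> ('a \<times> 'a) set" where
  "extensions U A x = {(u, y) \<in> U \<times> A. {x, u, y} \<in> E}"

lemma finite_extensions: "finite U \<Longrightarrow> finite A \<Longrightarrow> finite (extensions U A x)"
  unfolding extensions_def by (rule finite_subset[of _ "U \<times> A"]) auto

text \<open>Deleting \<open>x\<close> loses the extensions at \<open>x\<close> and the extensions of
  other vertices that lead to \<open>x\<close>. Reading an edge from either end shows that there are
  at most \<open>card (extensions U A x)\<close> of the latter, whence the factor 2.\<close>

lemma sum_extensions_remove:
  assumes fin: "finite U" "finite A" and x: "x \<in> A"
  shows "(\<Sum>z\<in>A. card (extensions U A z)) \<le>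
    (\<Sum>z\<in>A - {x}. card (extensions U (A - {x}) z)) + 2 * card (extensions U A x)"
proof -
  let ?B = "A - {x}"
  define N where "N = (\<lambda>z. {u \<in> U. {z, u, x} \<in> E})"
  have "card (extensions U A z) \<le> card (extensions U ?B z) + card (N z)" for z
  proof -
    have "extensions U A z \<subseteq> extensions U ?B z \<union> (\<lambda>u. (u, x)) ` N z"
      by (auto simp: extensions_def N_def)
    then have "card (extensions U A z) \<le> card (extensions U ?B z \<union> (\<lambda>u. (u, x)) ` N z)"
      using fin by (intro card_mono) (auto simp: finite_extensions N_def)
    also have "\<dots> \<le> card (extensions U ?B z) + card ((\<lambda>u. (u, x)) ` N z)" by (rule card_Un_le)
    also have "card ((\<lambda>u. (u, x)) ` N z) = card (N z)" by (rule card_image) (auto simp: inj_on_def)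
    finally show ?thesis .
  qed
  then have "(\<Sum>z\<in>?B. card (extensions U A z)) \<le> (\<Sum>z\<in>?B. card (extensions U ?B z)) + (\<Sum>z\<in>?B. card (N z))"
    by (simp add: sum_mono sum.distrib[symmetric])
  moreover have "(\<Sum>z\<in>?B. card (N z)) \<le> card (extensions U A x)"
  proof -
    have "(\<Sum>z\<in>?B. card (N z)) = card (Sigma ?B N)"
      using fin by (subst card_SigmaI) (auto simp: N_def)
    also have "\<dots> = card ((\<lambda>(z, u). (u, z)) ` Sigma ?B N)"
      by (intro card_image[symmetric]) (auto simp: inj_on_def)
    also have "\<dots> \<le> card (extensions U A x)"
      using fin by (intro card_mono finite_extensions)
        (auto simp: extensions_def N_def insert_commute)
    finally show ?thesis .
  qed
  moreover have "(\<Sum>z\<in>A. card (extensions U A z)) = card (extensions U A x) + (\<Sum>z\<in>?B. card (extensions U A z))"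
    using fin x by (simp add: sum.remove)
  ultimately show ?thesis by linarith
qed

text \<open>As for a subgraph of large minimum degree: delete vertices with few extensions one by one.\<close>

lemma exists_min_extensions:
  fixes \<kappa> :: real
  assumes "finite U" "finite A" "2 * \<kappa> * card A < (\<Sum>x\<in>A. card (extensions U A x))"
  shows "\<exists>A'. A' \<subseteq> A \<and> A' \<noteq> {} \<and> (\<forall>x\<in>A'. \<kappa> \<le> card (extensions U A' x))"
  using assms(2,3)
proof (induction "card A" arbitrary: A rule: less_induct)
  case less
  show ?case
  proof (cases "\<forall>x\<in>A. \<kappa> \<le> card (extensions U A x)")
    case True
    moreover have "A \<noteq> {}" using less.prems(2) by auto
    ultimately show ?thesis by blast
  next
    case False
    then obtain x where x: "x \<in> A" "card (extensions U A x) < \<kappa>" by auto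
    have c: "real (card A) = card (A - {x}) + 1" using x(1) less.prems(1)
      by (metis One_nat_def Suc_eq_plus1 card.remove of_nat_1 of_nat_add add.commute)
    have "real (\<Sum>z\<in>A. card (extensions U A z)) \<le>
        real ((\<Sum>z\<in>A - {x}. card (extensions U (A - {x}) z)) + 2 * card (extensions U A x))"
      using sum_extensions_remove[OF assms(1) less.prems(1) x(1)] of_nat_mono by blast
    \<comment> \<open>The sum loses less than \<open>2 * \<kappa>\<close>, while the other side
      drops by exactly \<open>2 * \<kappa>\<close>.\<close>
    then have "2 * \<kappa> * card (A - {x}) < (\<Sum>z\<in>A - {x}. card (extensions U (A - {x}) z))"
      using less.prems(2) x(2) c by (simp add: algebra_simps)
    then show ?thesis
      using less.hyps[of "A - {x}"] less.prems(1) x(1) card_Diff1_less[of A x] by blast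
  qed
qed

text \<open>The walk grows at its head, which stays in \<open>A\<close>. The used vertices block at
  most \<open>(2 * L + 1) * (card U + card A)\<close> extensions, fewer than
  \<open>\<kappa>\<close>. Each edge adds one middle vertex of weight at most
  \<open>\<alpha>\<close> and one end of weight at most \<open>\<mu>\<close>.\<close>

lemma exists_alternating_walk:
  fixes \<kappa> \<alpha> \<mu> :: real and w :: "'a \<Rightarrow> real"
  assumes fin: "finite U" "finite A" and A: "A \<noteq> {}" "\<And>x. x \<in> A \<Longrightarrow> \<kappa> \<le> card (extensions U A x)"
    and w: "\<And>u. u \<in> U \<Longrightarrow> w u \<le> \<alpha>" "\<And>x. x \<in> A \<Longrightarrow> w x \<le> \<mu>"
  shows "real (2 * L + 1) * (card U + card A) < \<kappa> \<Longrightarrow> \<exists>Q. loose_walk E Q \<and> distinct Q \<and>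
    length Q = 2 * L + 1 \<and> set Q \<subseteq> U \<union> A \<and> hd Q \<in> A \<and> sum w (set Q) \<le> L * (\<alpha> + \<mu>) + \<mu>"
proof (induction L)
  case 0
  obtain x where "x \<in> A" using A(1) by auto
  then show ?case using w(2) by (intro exI[of _ "[x]"]) (auto simp: loose_walk_def)
next
  case (Suc L)
  have le: "real (2 * L + 1) * (card U + card A) \<le> real (2 * Suc L + 1) * (card U + card A)"
    by (intro mult_right_mono) auto
  obtain Q where Q: "loose_walk E Q" "distinct Q" "length Q = 2 * L + 1" "set Q \<subseteq> U \<union> A"
    "hd Q \<in> A" "sum w (set Q) \<le> L * (\<alpha> + \<mu>) + \<mu>"
    using Suc.IH[OF le_less_trans[OF le Suc.prems]] by blast
  obtain x xs where x: "Q = x # xs" using Q(3) by (cases Q) auto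
  have xA: "x \<in> A" using Q(5) x by simp
  let ?F = "set Q"
  have cF: "card ?F = 2 * L + 1" using Q(2,3) distinct_card by metis
  have "card (?F \<times> A \<union> U \<times> ?F) \<le> card (?F \<times> A) + card (U \<times> ?F)" by (rule card_Un_le)
  also have "\<dots> = (2 * L + 1) * (card U + card A)"
    unfolding card_cartesian_product cF by (simp add: algebra_simps)
  finally have "real (card (?F \<times> A \<union> U \<times> ?F)) \<le> real ((2 * L + 1) * (card U + card A))"
    by (rule of_nat_mono)
  also have "\<dots> < card (extensions U A x)"
    using le Suc.prems A(2)[OF xA] unfolding of_nat_mult by linarith
  finally have "card (?F \<times> A \<union> U \<times> ?F) < card (extensions U A x)" by simp
  then obtain u y where uy: "(u, y) \<in> extensions U A x" "(u, y) \<notin> ?F \<times> A \<union> U \<times> ?F"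
    using nonempty_diff[of "?F \<times> A \<union> U \<times> ?F" "extensions U A x"] fin by auto
  then have uyA: "u \<in> U" "y \<in> A" "{y, u, x} \<in> E" "u \<notin> ?F" "y \<notin> ?F"
    by (auto simp: extensions_def insert_commute)
  have "u \<noteq> y" using edge_triple(4)[OF uyA(3)] by auto
  let ?Q = "y # u # Q"
  have "loose_walk E ?Q" using Q(1) uyA(3) x by (auto simp: loose_walk_def)
  moreover have "distinct ?Q" using Q(2) uyA \<open>u \<noteq> y\<close> by auto
  moreover have "sum w (set ?Q) \<le> Suc L * (\<alpha> + \<mu>) + \<mu>"
  proof -
    have "sum w (set ?Q) = w y + w u + sum w (set Q)" using uyA \<open>u \<noteq> y\<close> by simp
    also have "\<dots> \<le> \<mu> + \<alpha> + (L * (\<alpha> + \<mu>) + \<mu>)"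
      using w uyA Q(6) by (intro add_mono) auto
    finally show ?thesis by (simp add: algebra_simps)
  qed
  ultimately show ?case using Q(3,4) uyA by (intro exI[of _ ?Q]) auto
qed

text \<open>Per edge, \<open>2 * sum w R / card R\<close> is the average weight of two vertices. The
  terms with \<open>B\<close> pay for the \<open>k\<close> lightest vertices, for rounding the half
  of \<open>R\<close>, and for the additional end vertex.\<close>

lemma exists_light_walk:
  fixes w :: "'a \<Rightarrow> real" and \<rho> B :: real
  assumes tp: "typical \<rho> R" and R: "R \<subseteq> V" and \<rho>: "0 < \<rho>" "1 \<le> \<rho> * card R"
    and w: "\<And>v. v \<in> R \<Longrightarrow> 0 \<le> w v" "\<And>v. v \<in> R \<Longrightarrow> w v \<le> B"
    and k: "k < card R div 2" "8 * real (2 * L + 1) < k * \<rho>\<^sup>2"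
  shows "\<exists>Q. loose_walk E Q \<and> distinct Q \<and> length Q = 2 * L + 1 \<and> set Q \<subseteq> R \<and>
    sum w (set Q) \<le> L * (2 * sum w R + B * real (2 * k + 1)) / card R + B"
proof -
  define r m where "r = card R" and "m = r div 2"
  have finR: "finite R" using R finite_V finite_subset by blast
  have r: "0 < r" "m < r" using k(1) by (auto simp: r_def m_def)
  obtain M \<mu> where M: "M \<subseteq> R" "card M = m" "\<mu> \<in> w ` R" "\<forall>x\<in>M. w x \<le> \<mu>" "\<forall>x\<in>R - M. \<mu> \<le> w x"
    using threshold_subset[OF finR, of m w] r(2)[unfolded r_def] by blast
  have finM: "finite M" using M(1) finR finite_subset by blast
  have kM: "k < card M" using k(1) M(2) by (simp add: m_def r_def)
  obtain U \<alpha> where U: "U \<subseteq> M" "card U = k" "\<alpha> \<in> w ` M" "\<forall>x\<in>U. w x \<le> \<alpha>" "\<forall>x\<in>M - U. \<alpha> \<le> w x"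
    using threshold_subset[OF finM kM, of w] by blast
  have finU: "finite U" using U(1) finM finite_subset by blast
  have m: "2 * real m \<le> r" "real r - 1 \<le> 2 * real m" unfolding m_def by linarith+
  \<comment> \<open>The heavier half has at most \<open>(r + 1) / 2\<close> vertices, so
    \<open>\<rho> * r - 1 / 2\<close> vertices of \<open>S\<close> lie in \<open>M\<close>;
    \<open>1 \<le> \<rho> * r\<close> absorbs the rounding.\<close>
  have S: "\<rho> * r / 2 \<le> card (S \<inter> M)" if "(1 / 2 + \<rho>) * card R \<le> card (S \<inter> R)" for S
  proof -
    have "real (card (S \<inter> R)) - real (card (R - M)) \<le> card (S \<inter> R - (R - M))"
      using finR by (intro card_diff_ge) auto
    also have "S \<inter> R - (R - M) = S \<inter> M" using M(1) by auto
    finally have "real (card (S \<inter> R)) - (real r - real m) \<le> card (S \<inter> M)"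
      using M(1,2) finM r(2) by (simp add: card_Diff_subset r_def of_nat_diff)
    then show ?thesis using that m \<rho>(2) unfolding r_def[symmetric] by (simp add: algebra_simps)
  qed
  \<comment> \<open>Half of the total \<open>k * (\<rho> * r / 2)\<^sup>2\<close> of extensions,
    divided by \<open>r\<close>; as \<open>2 * card M \<le> r\<close>, the cleaning argument applies
    with this bound.\<close>
  define \<kappa> where "\<kappa> = k * \<rho>\<^sup>2 * r / 8"
  have k0: "0 < k" using k(2) by (cases k) auto
  have "2 * \<kappa> * card M < (\<Sum>x\<in>M. card (extensions U M x))"
  proof -
    have "2 * \<kappa> * card M \<le> \<kappa> * r"
      using m(1) M(2) mult_left_mono[of "2 * real m" r \<kappa>] by (simp add: \<kappa>_def)
    also have "\<dots> < k * ((\<rho> * r / 2) * (\<rho> * r / 2))"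
      using k0 r(1) \<rho>(1) by (simp add: \<kappa>_def power2_eq_square)
    also have "\<dots> \<le> card (Sigma U (\<lambda>u. Sigma (nbr u \<inter> M) (\<lambda>x. conbr u x \<inter> M)))"
      unfolding U(2)[symmetric]
    proof (rule card_Sigma_ge)
      fix u assume u: "u \<in> U"
      then have uV: "u \<in> V" using U(1) M(1) R by auto
      have "(\<rho> * r / 2) * (\<rho> * r / 2) \<le> card (nbr u \<inter> M) * (\<rho> * r / 2)"
        using S[OF typical_nbr[OF tp uV]] \<rho>(1) by (intro mult_right_mono) auto
      also have "\<dots> \<le> card (Sigma (nbr u \<inter> M) (\<lambda>x. conbr u x \<inter> M))"
        by (rule card_Sigma_ge) (use finM S[OF typical_conbr[OF tp]] in auto)
      finally show "(\<rho> * r / 2) * (\<rho> * r / 2) \<le> card (Sigma (nbr u \<inter> M) (\<lambda>x. conbr u x \<inter> M))" .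
    qed (use finU finM in auto)
    also have "card (Sigma U (\<lambda>u. Sigma (nbr u \<inter> M) (\<lambda>x. conbr u x \<inter> M))) =
        card ((\<lambda>(u, x, y). (x, u, y)) ` Sigma U (\<lambda>u. Sigma (nbr u \<inter> M) (\<lambda>x. conbr u x \<inter> M)))"
      by (intro card_image[symmetric]) (auto simp: inj_on_def)
    also have "real \<dots> \<le> card (Sigma M (extensions U M))"
      using finM finU by (intro of_nat_mono card_mono finite_SigmaI finite_extensions)
        (auto simp: extensions_def conbr_def insert_commute)
    also have "card (Sigma M (extensions U M)) = (\<Sum>x\<in>M. card (extensions U M x))"
      using finM finU by (intro card_SigmaI) (auto intro: finite_extensions)
    finally show ?thesis by simp
  qed
  then obtain A where A: "A \<subseteq> M" "A \<noteq> {}" "\<forall>x\<in>A. \<kappa> \<le> card (extensions U A x)"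
    using exists_min_extensions[OF finU finM] by blast
  have finA: "finite A" using A(1) finM finite_subset by blast
  have "card U \<le> card M" "card A \<le> card M" using finM U(1) A(1) by (auto intro: card_mono)
  then have "real (card U + card A) \<le> r" using m(1) M(2) by simp
  then have "real (2 * L + 1) * (card U + card A) \<le> real (2 * L + 1) * r"
    by (intro mult_left_mono) auto
  also have "\<dots> < \<kappa>"
    using mult_strict_right_mono[OF k(2), of "real r"] r(1) unfolding \<kappa>_def by (simp add: algebra_simps)
  finally have "\<exists>Q. loose_walk E Q \<and> distinct Q \<and>
    length Q = 2 * L + 1 \<and> set Q \<subseteq> U \<union> A \<and> hd Q \<in> A \<and> sum w (set Q) \<le> L * (\<alpha> + \<mu>) + \<mu>"
    using A U(4) M(4) by (intro exists_alternating_walk[OF finU finA, of \<kappa>]) auto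
  then obtain Q where Q: "loose_walk E Q" "distinct Q" "length Q = 2 * L + 1" "set Q \<subseteq> U \<union> A"
    "sum w (set Q) \<le> L * (\<alpha> + \<mu>) + \<mu>" by blast
  have \<alpha>: "0 \<le> \<alpha>" "\<alpha> \<le> B" using U(3) M(1) w by auto
  have \<mu>: "0 \<le> \<mu>" "\<mu> \<le> B" using M(3) w by auto
  \<comment> \<open>Each vertex of \<open>R - M\<close> weighs at least \<open>\<mu>\<close> and
    each of \<open>M - U\<close> at least \<open>\<alpha>\<close>. Twice these bounds gives the
    claim up to the error \<open>(2 * k + 1) * B\<close>.\<close>
  have "r * (\<alpha> + \<mu>) \<le> 2 * sum w R + B * (2 * k + 1)"
  proof -
    have "sum w R = sum w (R - M) + (sum w (M - U) + sum w U)"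
      using sum.subset_diff[OF M(1) finR, of w] sum.subset_diff[OF U(1) finM, of w] by simp
    moreover have "(real r - real m) * \<mu> \<le> sum w (R - M)"
      using sum_bounded_below[of "R - M" \<mu> w] M finM r(2)
      by (simp add: card_Diff_subset r_def of_nat_diff)
    moreover have "(real m - real k) * \<alpha> \<le> sum w (M - U)"
      using sum_bounded_below[of "M - U" \<alpha> w] U finU M(2) k(1)
      by (simp add: card_Diff_subset of_nat_diff m_def r_def)
    moreover have "0 \<le> sum w U" using U(1) M(1) w by (intro sum_nonneg) auto
    moreover have "(real r - 2 * real m + 2 * real k) * \<alpha> \<le> (2 * k + 1) * B"
      using \<alpha> m by (intro mult_mono) auto
    moreover have "0 \<le> (real r - 2 * real m) * \<mu>" using \<mu> m by simp
    ultimately show ?thesis by (simp add: algebra_simps)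
  qed
  then have "\<alpha> + \<mu> \<le> (2 * sum w R + B * (2 * k + 1)) / r"
    using r(1) by (simp add: field_simps)
  then have "L * (\<alpha> + \<mu>) + \<mu> \<le> L * ((2 * sum w R + B * (2 * k + 1)) / r) + B"
    using \<mu> by (intro add_mono mult_left_mono) auto
  then have "sum w (set Q) \<le> L * (2 * sum w R + B * (2 * k + 1)) / card R + B"
    using Q(5) by (simp add: r_def)
  moreover have "set Q \<subseteq> R" using Q(4) U(1) A(1) M(1) by auto
  ultimately show ?thesis using Q by blast
qed

end

section \<open>Keeping the remaining vertices typical\<close>

text \<open>For negative \<open>x\<close>, \<open>1 - x \<le> exp (- x)\<close> and
  \<open>(1 + x + x\<^sup>2) * (1 - x) = 1 - x ^ 3\<close> is at least 1.\<close>

lemma exp_le_quadratic: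
  fixes x :: real
  assumes "\<bar>x\<bar> \<le> 1"
  shows "exp x \<le> 1 + x + x\<^sup>2"
proof (cases "0 \<le> x")
  case True
  then show ?thesis using exp_bound assms by auto
next
  case False
  have "(1 + x + x\<^sup>2) * (1 - x) = 1 - x ^ 3" by (simp add: algebra_simps power2_eq_square power3_eq_cube)
  moreover have "x ^ 3 \<le> 0" using False by (simp add: power_le_zero_eq)
  ultimately have "1 \<le> (1 + x + x\<^sup>2) * (1 - x)" by simp
  also have "\<dots> \<le> (1 + x + x\<^sup>2) * exp (- x)"
  proof (rule mult_left_mono)
    show "1 - x \<le> exp (- x)" using exp_ge_add_one_self[of "- x"] by simp
    show "0 \<le> 1 + x + x\<^sup>2" using assms by (simp add: abs_le_iff)
  qed
  finally show ?thesis by (simp add: exp_minus field_simps)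
qed

text \<open>Isolates the change of a density \<open>A / r\<close> when a set containing
  \<open>B\<close> of the \<open>A\<close> elements is removed and the size drops to
  \<open>r'\<close>.\<close>

lemma ratio_remove:
  fixes r r' :: real
  assumes "r \<noteq> 0" "r' \<noteq> 0"
  shows "l * (c - (A - B) / r') = l * (c - A / r) + l * (r * B - (r - r') * A) / (r * r')"
proof -
  have "(A - B) / r' = A / r - (r * B - (r - r') * A) / (r * r')"
    using assms by (simp add: field_simps)
  moreover define X where "X = r * B - (r - r') * A"
  ultimately show ?thesis by (simp add: right_diff_distrib)
qed

section \<open>The exponential potential of the tests\<close>

context finite_three_graph
begin

text \<open>An exponential penalty: for positive \<open>l\<close> it is at least 1 exactly when
  \<open>S\<close> has density at most \<open>1 / 2 + \<rho>\<close> in \<open>R\<close>.\<close>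

definition tilt :: "real \<Rightarrow> real \<Rightarrow> 'a set \<Rightarrow> 'a set \<Rightarrow> real" where
  "tilt l \<rho> R S = exp (l * (1 / 2 + \<rho> - card (S \<inter> R) / card R))"

definition potential :: "real \<Rightarrow> real \<Rightarrow> 'a set \<Rightarrow> real" where
  "potential l \<rho> R = (\<Sum>S\<in>tests. tilt l \<rho> R S)"

lemma typical_of_potential:
  assumes "potential l \<rho> R < 1" "0 \<le> l" "0 < card R"
  shows "typical \<rho> R"
  unfolding typical_def
proof (rule ballI, rule ccontr)
  fix S assume S: "S \<in> tests" "\<not> (1 / 2 + \<rho>) * card R \<le> card (S \<inter> R)"
  then have "0 \<le> l * (1 / 2 + \<rho> - card (S \<inter> R) / card R)"
    using assms(2,3) by (intro mult_nonneg_nonneg) (auto simp: field_simps)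
  then have "1 \<le> tilt l \<rho> R S" by (simp add: tilt_def)
  also have "\<dots> \<le> potential l \<rho> R"
    unfolding potential_def using S(1) finite_tests by (intro member_le_sum) (auto simp: tilt_def)
  finally show False using assms(1) by simp
qed

text \<open>Removing \<open>D\<close> changes the exponent of each test by \<open>\<xi> S\<close>,
  of size at most \<open>q\<close>. The assumption \<open>light\<close> makes the weighted
  first-order change at most \<open>q * \<delta>\<close> times the potential, and the second-order
  term is at most \<open>q\<^sup>2 \<le> q * \<delta>\<close> times it.\<close>

lemma potential_remove:
  fixes l \<rho> \<delta> :: real
  assumes R: "finite R" and D: "D \<subseteq> R" "card D < card R" and l: "0 \<le> l"
    and \<delta>: "0 \<le> \<delta>" "\<delta> \<le> 1" "l * card D \<le> \<delta> * card (R - D)"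
    and light: "(\<Sum>S\<in>tests. tilt l \<rho> R S * card (S \<inter> D)) \<le>
      (1 + \<delta>) * card D / card R * (\<Sum>S\<in>tests. tilt l \<rho> R S * card (S \<inter> R))"
  shows "potential l \<rho> (R - D) \<le> exp (2 * l * \<delta> * card D / card (R - D)) * potential l \<rho> R"
proof -
  define r d r' where "r = real (card R)" and "d = real (card D)" and "r' = real (card (R - D))"
  have finD: "finite D" using D(1) R finite_subset by blast
  have r': "r' = r - d" "0 < r'" "0 < r"
    using D R finD by (auto simp: r_def d_def r'_def card_Diff_subset of_nat_diff card_mono)
  have d0: "0 \<le> d" by (simp add: d_def)
  let ?t = "tilt l \<rho> R"
  define \<xi> where "\<xi> S = l * (r * card (S \<inter> D) - d * card (S \<inter> R)) / (r * r')" for S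
  define q where "q = l * d / r'"
  have q: "0 \<le> q" "q \<le> \<delta>"
    using l d0 r' \<delta>(3) by (auto simp: q_def field_simps r'_def[symmetric] d_def[symmetric])
  have \<xi>_le: "\<bar>\<xi> S\<bar> \<le> q" for S
  proof -
    have 1: "real (card (S \<inter> D)) \<le> d" "real (card (S \<inter> R)) \<le> r"
      using finD R by (auto simp: d_def r_def intro: card_mono)
    have 2: "r * card (S \<inter> D) \<le> r * d" "d * card (S \<inter> R) \<le> d * r"
      using 1 d0 r' by (auto intro: mult_left_mono)
    have "0 \<le> r * card (S \<inter> D)" "0 \<le> d * card (S \<inter> R)" using d0 r' by auto
    then have "\<bar>r * card (S \<inter> D) - d * card (S \<inter> R)\<bar> \<le> r * d" using 2 by (simp add: abs_le_iff mult.commute)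
    then have "l * \<bar>r * card (S \<inter> D) - d * card (S \<inter> R)\<bar> / (r * r') \<le> l * (r * d) / (r * r')"
      using l r' by (intro divide_right_mono mult_left_mono) auto
    moreover have "l * (r * d) / (r * r') = q" using r' by (simp add: q_def)
    ultimately show ?thesis using l r' by (simp add: \<xi>_def abs_mult)
  qed
  have step: "tilt l \<rho> (R - D) S \<le> ?t S * (1 + \<xi> S + q\<^sup>2)" for S
  proof -
    have "card (S \<inter> (R - D)) = card (S \<inter> R) - card (S \<inter> D)"
      using R D finD by (metis Diff_Int_distrib card_Diff_subset finite_Int inf.mono order_refl)
    moreover have "card (S \<inter> D) \<le> card (S \<inter> R)" using R D by (intro card_mono) auto
    ultimately have c: "real (card (S \<inter> (R - D))) = real (card (S \<inter> R)) - real (card (S \<inter> D))"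
      by (simp add: of_nat_diff)
    have "l * (1 / 2 + \<rho> - card (S \<inter> (R - D)) / r') = l * (1 / 2 + \<rho> - card (S \<inter> R) / r) + \<xi> S"
    proof -
      have d: "d = r - r'" using r' by simp
      show ?thesis unfolding c \<xi>_def d by (rule ratio_remove) (use r' in auto)
    qed
    then have "tilt l \<rho> (R - D) S = ?t S * exp (\<xi> S)"
      by (simp add: tilt_def r_def r'_def exp_add)
    also have "\<dots> \<le> ?t S * (1 + \<xi> S + q\<^sup>2)"
    proof (rule mult_left_mono)
      have "exp (\<xi> S) \<le> 1 + \<xi> S + (\<xi> S)\<^sup>2"
        using \<xi>_le[of S] q \<delta>(2) by (intro exp_le_quadratic) auto
      moreover have "(\<xi> S)\<^sup>2 \<le> q\<^sup>2" using \<xi>_le[of S] q by (simp add: power2_le_iff_abs_le)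
      ultimately show "exp (\<xi> S) \<le> 1 + \<xi> S + q\<^sup>2" by simp
    qed (simp add: tilt_def)
    finally show ?thesis .
  qed
  define X where "X = (\<Sum>S\<in>tests. ?t S * card (S \<inter> R))"
  have X: "0 \<le> X" "X \<le> r * potential l \<rho> R"
  proof -
    show "0 \<le> X" unfolding X_def by (intro sum_nonneg) (auto simp: tilt_def)
    have "X \<le> (\<Sum>S\<in>tests. ?t S * r)"
      unfolding X_def using R by (intro sum_mono mult_left_mono) (auto simp: tilt_def r_def intro: card_mono)
    then show "X \<le> r * potential l \<rho> R"
      unfolding potential_def sum_distrib_left by (simp add: mult.commute)
  qed
  have drift: "(\<Sum>S\<in>tests. ?t S * \<xi> S) \<le> q * \<delta> * potential l \<rho> R"
  proof -
    \<comment> \<open>If \<open>D\<close> had exactly average load, this difference would vanish;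
      only the relative excess \<open>\<delta>\<close> survives.\<close>
    have "(\<Sum>S\<in>tests. ?t S * \<xi> S) =
        l / (r * r') * (r * (\<Sum>S\<in>tests. ?t S * card (S \<inter> D)) - d * X)"
      unfolding X_def sum_distrib_left sum_subtractf[symmetric]
      by (intro sum.cong refl) (simp add: \<xi>_def algebra_simps diff_divide_distrib)
    also have "\<dots> \<le> l / (r * r') * (r * ((1 + \<delta>) * d / r * X) - d * X)"
      using light l r' unfolding X_def r_def[symmetric] d_def[symmetric]
      by (intro mult_left_mono diff_right_mono) auto
    also have "\<dots> = q * \<delta> * (X / r)"
      using r' by (simp add: q_def field_simps)
    also have "\<dots> \<le> q * \<delta> * potential l \<rho> R"
      using X r' q \<delta> by (intro mult_left_mono) (auto simp: field_simps)
    finally show ?thesis .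
  qed
  have "potential l \<rho> (R - D) \<le> (\<Sum>S\<in>tests. ?t S * (1 + \<xi> S + q\<^sup>2))"
    unfolding potential_def by (intro sum_mono step)
  also have "\<dots> = potential l \<rho> R + (\<Sum>S\<in>tests. ?t S * \<xi> S) + q\<^sup>2 * potential l \<rho> R"
    unfolding potential_def by (simp add: algebra_simps sum.distrib sum_distrib_left)
  also have "\<dots> \<le> potential l \<rho> R + q * \<delta> * potential l \<rho> R + (q * \<delta>) * potential l \<rho> R"
  proof -
    have "0 \<le> potential l \<rho> R" unfolding potential_def by (intro sum_nonneg) (auto simp: tilt_def)
    moreover have "q\<^sup>2 \<le> q * \<delta>" using q by (simp add: power2_eq_square mult_left_mono)
    ultimately show ?thesis using drift by (intro add_mono mult_right_mono) auto
  qed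
  also have "\<dots> = (1 + 2 * q * \<delta>) * potential l \<rho> R" by (simp add: algebra_simps)
  also have "\<dots> \<le> exp (2 * q * \<delta>) * potential l \<rho> R"
  proof (intro mult_right_mono exp_ge_add_one_self)
    show "0 \<le> potential l \<rho> R" unfolding potential_def by (intro sum_nonneg) (auto simp: tilt_def)
  qed
  also have "2 * q * \<delta> = 2 * l * \<delta> * card D / card (R - D)"
    by (simp add: q_def d_def r'_def)
  finally show ?thesis .
qed

text \<open>The vertex weight whose sum over \<open>D\<close> controls the first-order change of the potential when \<open>D\<close> is removed.\<close>

definition load :: "real \<Rightarrow> real \<Rightarrow> 'a set \<Rightarrow> 'a \<Rightarrow> real" where
  "load l \<rho> R v = (\<Sum>S\<in>tests. tilt l \<rho> R S * of_bool (v \<in> S))"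

lemma sum_load: "finite A \<Longrightarrow> sum (load l \<rho> R) A = (\<Sum>S\<in>tests. tilt l \<rho> R S * card (S \<inter> A))"
  unfolding load_def
  by (subst sum.swap) (simp add: sum_distrib_left[symmetric] sum.If_cases of_bool_def Int_def conj_commute)

lemma load_bounds: "0 \<le> load l \<rho> R v" "load l \<rho> R v \<le> potential l \<rho> R"
  unfolding load_def potential_def by (auto intro!: sum_nonneg sum_mono simp: tilt_def)

text \<open>A light walk avoids overloading the tests. The connecting vertices are bounded only by
  the full potential, which is harmless because \<open>L\<close> is large compared with
  \<open>1 / \<delta>\<close>.\<close>

lemma extend_walk:
  fixes l \<rho> \<delta> :: real
  assumes tp: "typical \<rho> R" and R: "R \<subseteq> V" and x: "x \<in> V - R"
    and \<rho>: "0 < \<rho>" "\<rho> \<le> 1 / 2" "1 \<le> \<rho> * card R" "2 * real L + 4 < 2 * \<rho> * card R"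
    and l: "0 \<le> l" and \<delta>: "0 < \<delta>" "\<delta> \<le> 1" "4 \<le> \<delta> * L" "l * real (2 * L + 4) \<le> \<delta> * (real (card R) - real (2 * L + 4))"
    and k: "k < card R div 2" "8 * real (2 * L + 1) < k * \<rho>\<^sup>2" "2 * real (2 * k + 1) \<le> \<delta> * card R"
    and big: "2 * L + 4 < card R"
  obtains b z b' Q where "{x, b, z} \<in> E" "{z, b', hd Q} \<in> E" "loose_walk E Q"
    "distinct (b # z # b' # Q)" "set (b # z # b' # Q) \<subseteq> R" "length Q = 2 * L + 1"
    "potential l \<rho> (R - set (b # z # b' # Q)) \<le>
      exp (2 * l * \<delta> * real (2 * L + 4) / (real (card R) - real (2 * L + 4))) * potential l \<rho> R"
proof -
  have finR: "finite R" using R finite_V finite_subset by blast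
  define r where "r = real (card R)"
  have r: "0 < r" using big by (simp add: r_def)
  let ?w = "load l \<rho> R" and ?B = "potential l \<rho> R"
  define W where "W = sum ?w R"
  have B0: "0 \<le> ?B" unfolding potential_def by (intro sum_nonneg) (auto simp: tilt_def)
  \<comment> \<open>Typicality bounds the average load below by half of the potential, so terms in
    \<open>?B\<close> can be traded for average load.\<close>
  have W: "r * ?B \<le> 2 * W"
  proof -
    have "r / 2 * ?B = (\<Sum>S\<in>tests. tilt l \<rho> R S * (r / 2))"
      unfolding potential_def by (subst mult.commute) (rule sum_distrib_right)
    also have "\<dots> \<le> (\<Sum>S\<in>tests. tilt l \<rho> R S * card (S \<inter> R))"
    proof (intro sum_mono mult_left_mono)
      fix S assume "S \<in> tests"
      then have "(1 / 2 + \<rho>) * r \<le> card (S \<inter> R)" using tp by (simp add: typical_def r_def)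
      moreover have "1 / 2 * r \<le> (1 / 2 + \<rho>) * r" using \<rho>(1) r by (intro mult_right_mono) auto
      ultimately show "r / 2 \<le> card (S \<inter> R)" by simp
    qed (simp add: tilt_def)
    finally show ?thesis using sum_load[OF finR] by (simp add: W_def)
  qed
  obtain Q where Q: "loose_walk E Q" "distinct Q" "length Q = 2 * L + 1" "set Q \<subseteq> R"
    "sum ?w (set Q) \<le> L * (2 * W + ?B * real (2 * k + 1)) / r + ?B"
    using exists_light_walk[OF tp R \<rho>(1,3) _ _ k(1,2), of ?w ?B] load_bounds
    unfolding W_def r_def by blast
  have neQ: "Q \<noteq> []" using Q(3) by auto
  have hdQ: "hd Q \<in> V" "hd Q \<in> set Q" using hd_in_set[OF neQ] Q(4) R by blast+
  let ?F = "insert x (set Q)"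
  have cF: "real (card ?F) + 2 < 2 * \<rho> * card R"
    using \<rho>(4) Q(2,3,4) x by (simp add: distinct_card card_insert_if)
  obtain b z b' where con: "{x, b, z} \<in> E" "{z, b', hd Q} \<in> E" "distinct [b, z, b']"
    "{b, z, b'} \<subseteq> R - ?F"
    by (rule connect[OF tp R \<rho>(1,2) _ _ _ _ _ cF, of x "hd Q"]) (use x hdQ in auto)
  let ?D = "set (b # z # b' # Q)"
  have dist: "distinct (b # z # b' # Q)" using con(3,4) Q(2) by auto
  have cD: "card ?D = 2 * L + 4" using distinct_card[OF dist] Q(3) by simp
  have D: "?D \<subseteq> R" using con(4) Q(4) by auto
  have cRD: "real (card (R - ?D)) = real (card R) - real (2 * L + 4)"
    using card_Diff_subset[OF _ D] cD big by (simp add: of_nat_diff)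
  have sumD: "sum ?w ?D \<le> (1 + \<delta>) * real (2 * L + 4) / r * W"
  proof -
    have "sum ?w ?D = ?w b + ?w z + ?w b' + sum ?w (set Q)" using dist by simp
    also have "\<dots> \<le> ?B + ?B + ?B + (L * (2 * W + ?B * real (2 * k + 1)) / r + ?B)"
      by (intro add_mono load_bounds Q(5))
    also have "\<dots> = 4 * ?B + L * (2 * W + ?B * real (2 * k + 1)) / r" by simp
    also have "\<dots> \<le> 4 * ?B + L * (2 * W + \<delta> * W) / r"
    proof -
      have "2 * (?B * real (2 * k + 1)) = ?B * (2 * real (2 * k + 1))" by (simp only: mult.left_commute)
      also have "\<dots> \<le> ?B * (\<delta> * r)"
        using k(3) B0 by (intro mult_left_mono) (auto simp: r_def)
      also have "\<dots> = \<delta> * (r * ?B)" by simp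
      also have "\<dots> \<le> \<delta> * (2 * W)" using W \<delta>(1) by (intro mult_left_mono) auto
      also have "\<dots> = 2 * (\<delta> * W)" by simp
      finally have "?B * real (2 * k + 1) \<le> \<delta> * W" by (rule mult_left_le_imp_le) simp
      then show ?thesis using r by (intro add_mono divide_right_mono mult_left_mono) auto
    qed
    also have "\<dots> \<le> 8 * W / r + L * (2 * W + \<delta> * W) / r"
      using W r by (simp add: field_simps)
    also have "\<dots> = (8 + 2 * real L + \<delta> * real L) * W / r" by (simp add: algebra_simps add_divide_distrib)
    also have "\<dots> \<le> ((1 + \<delta>) * real (2 * L + 4)) * W / r"
    proof (intro divide_right_mono mult_right_mono)
      \<comment> \<open>This is where \<open>4 \<le> \<delta> * L\<close> enters: the other half of
        \<open>2 * \<delta> * L\<close> pays for the three connecting vertices and the additional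
        end.\<close>
      show "8 + 2 * real L + \<delta> * real L \<le> (1 + \<delta>) * real (2 * L + 4)"
        using \<delta> by (simp add: algebra_simps)
      show "0 \<le> W" unfolding W_def by (intro sum_nonneg load_bounds)
    qed (use r in simp)
    finally show ?thesis by simp
  qed
  have "potential l \<rho> (R - ?D) \<le> exp (2 * l * \<delta> * card ?D / card (R - ?D)) * ?B"
  proof (rule potential_remove[OF finR D _ l])
    show "card ?D < card R" using big cD by simp
    show "0 \<le> \<delta>" "\<delta> \<le> 1" using \<delta> by auto
    show "l * card ?D \<le> \<delta> * card (R - ?D)" using \<delta>(4) unfolding cD cRD .
    show "(\<Sum>S\<in>tests. tilt l \<rho> R S * card (S \<inter> ?D)) \<le>
      (1 + \<delta>) * card ?D / card R * (\<Sum>S\<in>tests. tilt l \<rho> R S * card (S \<inter> R))"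
      using sumD unfolding sum_load[OF finite_set] cD W_def r_def sum_load[OF finR] .
  qed
  then have "potential l \<rho> (R - ?D) \<le>
      exp (2 * l * \<delta> * real (2 * L + 4) / (real (card R) - real (2 * L + 4))) * ?B"
    unfolding cD cRD .
  then show ?thesis using that[OF con(1,2) Q(1) dist D Q(3)] by blast
qed

text \<open>At least \<open>N\<close> vertices remain after each piece, so removing \<open>d\<close>
  vertices costs a factor of at most \<open>exp (2 * l * \<delta> / N * d)\<close>. The exponential
  in the last premise is a budget that shrinks by the same factor, so the product stays below 1 and
  \<open>R\<close> stays typical.\<close>

lemma exists_long_walk:
  fixes l \<rho> \<delta> :: real
  assumes \<rho>: "0 < \<rho>" "\<rho> \<le> 1 / 2" "1 \<le> \<rho> * N" "2 * real L + 4 < 2 * \<rho> * N"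
    and l: "0 \<le> l" and \<delta>: "0 < \<delta>" "\<delta> \<le> 1" "4 \<le> \<delta> * L" "l * real (2 * L + 4) \<le> \<delta> * N"
    and k: "k < N div 2" "8 * real (2 * L + 1) < k * \<rho>\<^sup>2" "2 * real (2 * k + 1) \<le> \<delta> * N"
  shows "loose_walk E P \<Longrightarrow> distinct P \<Longrightarrow> set P \<subseteq> V \<Longrightarrow> N \<le> card (V - set P) \<Longrightarrow>
    potential l \<rho> (V - set P) * exp (2 * l * \<delta> / N * card (V - set P)) < 1 \<Longrightarrow>
    \<exists>Q. loose_walk E Q \<and> distinct Q \<and> set Q \<subseteq> V \<and> set (triples P) \<subseteq> set (triples Q) \<and>
      typical \<rho> (V - set Q) \<and> N \<le> card (V - set Q) \<and> card (V - set Q) < N + (2 * L + 4)"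
proof (induction "card (V - set P)" arbitrary: P rule: less_induct)
  case less
  define R where "R = V - set P"
  define d where "d = 2 * L + 4"
  have N0: "0 < N" using k(1) by (cases N) auto
  have NR: "N \<le> card R" using less.prems(4) by (simp add: R_def)
  have pot0: "0 \<le> potential l \<rho> R" unfolding potential_def by (intro sum_nonneg) (auto simp: tilt_def)
  have exp1: "1 \<le> exp (2 * l * \<delta> / N * card R)" using l \<delta> by simp
  have "potential l \<rho> R * 1 \<le> potential l \<rho> R * exp (2 * l * \<delta> / N * card R)"
    using mult_left_mono[OF exp1 pot0] .
  then have "potential l \<rho> R < 1" using less.prems(5) by (simp add: R_def)
  then have tp: "typical \<rho> R" using l N0 NR by (intro typical_of_potential) auto
  show ?case
  proof (cases "card R < N + d")
    case True
    then show ?thesis using less.prems tp NR by (intro exI[of _ P]) (auto simp: R_def d_def)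
  next
    case False
    have ne: "P \<noteq> []" using less.prems(1) by (auto simp: loose_walk_def)
    have mono: "\<rho> * N \<le> \<rho> * card R" "\<delta> * N \<le> \<delta> * card R"
      using NR \<rho>(1) \<delta>(1) by (auto intro: mult_left_mono)
    have rd: "real N \<le> real (card R) - real d" using False by linarith
    have "\<delta> * N \<le> \<delta> * (real (card R) - real d)" using rd \<delta>(1) by (intro mult_left_mono) auto
    then have big: "l * real (2 * L + 4) \<le> \<delta> * (real (card R) - real (2 * L + 4))"
      using \<delta>(4) by (simp add: d_def)
    obtain b z b' Q where Q: "{last P, b, z} \<in> E" "{z, b', hd Q} \<in> E" "loose_walk E Q"
      "distinct (b # z # b' # Q)" "set (b # z # b' # Q) \<subseteq> R" "length Q = 2 * L + 1"
      "potential l \<rho> (R - set (b # z # b' # Q)) \<le>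
        exp (2 * l * \<delta> * real (2 * L + 4) / (real (card R) - real (2 * L + 4))) * potential l \<rho> R"
    proof (rule extend_walk[OF tp, of "last P" L l \<delta> k])
      show "R \<subseteq> V" by (auto simp: R_def)
      show "last P \<in> V - R" using ne less.prems(3) by (auto simp: R_def)
      show "k < card R div 2" using k(1) NR by linarith
      show "2 * L + 4 < card R" using False N0 by (simp add: d_def)
      show "1 \<le> \<rho> * card R" "2 * real L + 4 < 2 * \<rho> * card R" using \<rho>(3,4) mono(1) by linarith+
      show "2 * real (2 * k + 1) \<le> \<delta> * card R" using k(3) mono(2) by linarith
    qed (use \<rho> l \<delta> k big in auto)
    let ?D = "set (b # z # b' # Q)"
    let ?P = "P @ b # z # b' # Q"
    have cD: "card ?D = d" using distinct_card[OF Q(4)] Q(6) by (simp add: d_def)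
    have R': "V - set ?P = R - ?D" by (auto simp: R_def)
    have cR': "card (R - ?D) = card R - d"
      using card_Diff_subset[OF _ Q(5)] cD by simp
    have walk: "loose_walk E ?P" and tri: "set (triples P) \<subseteq> set (triples ?P)"
      using loose_walk_join[OF less.prems(1) Q(3,1,2)] by auto
    have dist: "distinct ?P" using less.prems(2) Q(4,5) by (auto simp: R_def)
    have sub: "set ?P \<subseteq> V" using less.prems(3) Q(5) by (auto simp: R_def)
    have "potential l \<rho> (R - ?D) * exp (2 * l * \<delta> / N * card (R - ?D)) \<le>
      (exp (2 * l * \<delta> / N * d) * potential l \<rho> R) * exp (2 * l * \<delta> / N * card (R - ?D))"
    proof (rule mult_right_mono)
      have "2 * l * \<delta> * real d / (real (card R) - real d) \<le> 2 * l * \<delta> * real d / N"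
        using rd N0 l \<delta>(1) by (intro divide_left_mono) auto
      then have "exp (2 * l * \<delta> * real d / (real (card R) - real d)) * potential l \<rho> R \<le>
          exp (2 * l * \<delta> / N * d) * potential l \<rho> R"
        using pot0 by (intro mult_right_mono) auto
      then show "potential l \<rho> (R - ?D) \<le> exp (2 * l * \<delta> / N * d) * potential l \<rho> R"
        using Q(7) unfolding d_def by linarith
    qed simp
    also have "\<dots> = potential l \<rho> R * (exp (2 * l * \<delta> / N * d) * exp (2 * l * \<delta> / N * card (R - ?D)))"
      by simp
    also have "exp (2 * l * \<delta> / N * d) * exp (2 * l * \<delta> / N * card (R - ?D)) = exp (2 * l * \<delta> / N * card R)"
    proof -
      have "real (card R) = real d + real (card (R - ?D))" using cR' False by simp
      then show ?thesis by (simp only: exp_add[symmetric] distrib_left)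
    qed
    also have "potential l \<rho> R * \<dots> < 1" using less.prems(5) by (simp add: R_def)
    finally have pot: "potential l \<rho> (V - set ?P) * exp (2 * l * \<delta> / N * card (V - set ?P)) < 1"
      unfolding R' .
    have less': "card (V - set ?P) < card (V - set P)"
      unfolding R' cR' using False N0 by (simp add: d_def R_def)
    have NR': "N \<le> card (V - set ?P)" unfolding R' cR' using False by simp
    show ?thesis using less.hyps[OF less' walk dist sub NR' pot] tri by blast
  qed
qed

section \<open>The Hamiltonian cycle\<close>

text \<open>The path is first closed by a connection inside the remaining set, then the leftover is
  absorbed. Absorption fixes both ends, so the connection still fits. At most \<open>2 * q\<close>
  vertices are left over.\<close>

lemma close_walk:
  fixes \<rho> :: real
  assumes P: "loose_walk E P" "distinct P" "set P \<subseteq> V" and T: "T \<subseteq> set (triples P)"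
    and abs: "\<And>u v. u \<in> V \<Longrightarrow> v \<in> V \<Longrightarrow> q \<le> card {t \<in> T. absorbs E (u, v) t}"
    and tp: "typical \<rho> (V - set P)" and \<rho>: "0 < \<rho>" "\<rho> \<le> 1 / 2" "4 < 2 * \<rho> * card (V - set P)"
    and q: "card (V - set P) \<le> 2 * q + 3" and ev: "even (card V)"
  obtains Q where "distinct Q" "set Q = V" "loose_walk E (Q @ [hd Q])"
proof -
  define R where "R = V - set P"
  have finR: "finite R" using finite_V by (simp add: R_def)
  have ne: "P \<noteq> []" using P by (auto simp: loose_walk_def)
  have "card {last P, hd P} \<le> 2" by (simp add: card_insert_le_m1)
  then have cF: "real (card {last P, hd P}) + 2 < 2 * \<rho> * card (V - set P)" using \<rho>(3) by linarith
  obtain b z b' where con: "{last P, b, z} \<in> E" "{z, b', hd P} \<in> E" "distinct [b, z, b']"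
    "{b, z, b'} \<subseteq> (V - set P) - {last P, hd P}"
    by (rule connect[OF tp _ \<rho>(1,2) _ _ _ _ _ cF, of "last P" "hd P"]) (use P(3) ne in auto)
  define W where "W = R - {b, z, b'}"
  have bR: "{b, z, b'} \<subseteq> R" using con(4) by (auto simp: R_def)
  have "card {b, z, b'} = 3" using con(3) by auto
  then have cR: "card R = card W + 3"
    using card_Diff_subset[OF _ bR] card_mono[OF finR bR] by (simp add: W_def)
  have "card V = card (set P) + card R"
    using card_Diff_subset[OF _ P(3)] card_mono[OF finite_V P(3)] by (simp add: R_def)
  \<comment> \<open>Parity: an odd path and three connecting vertices leave an even number out of an
    even total.\<close>
  moreover have "odd (card (set P))" using P(1,2) by (simp add: distinct_card loose_walk_def)
  ultimately have "even (card W)" using ev cR by presburger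
  then obtain m where m: "card W = 2 * m" by blast
  have mq: "m \<le> q" using m cR q by (simp add: R_def)
  have "\<exists>P'. loose_walk E P' \<and> distinct P' \<and> set P' = set P \<union> W \<and> hd P' = hd P \<and> last P' = last P"
  proof (rule absorb_set[OF P(1,2) T _ m])
    show "finite W" using finR by (simp add: W_def)
    show "W \<inter> set P = {}" by (auto simp: W_def R_def)
    fix u v assume "u \<in> W" "v \<in> W" "u \<noteq> v"
    then show "m \<le> card {t \<in> T. absorbs E (u, v) t}"
      using abs[of u v] mq by (simp add: W_def R_def)
  qed
  then obtain P' where P': "loose_walk E P'" "distinct P'" "set P' = set P \<union> W" "hd P' = hd P" "last P' = last P"
    by blast
  let ?Q = "P' @ [b, z, b']"
  have ne': "P' \<noteq> []" using P'(1) by (auto simp: loose_walk_def)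
  show ?thesis
  proof
    show "distinct ?Q" using P'(2,3) con(3,4) by (auto simp: W_def)
    show "set ?Q = V" using P'(3) bR P(3) by (auto simp: W_def R_def)
    have "loose_walk E (P' @ b # z # b' # [hd P'])"
      using con(1,2) P'(4,5) by (intro loose_walk_join(1)[OF P'(1)]) (auto simp: loose_walk_def)
    then show "loose_walk E (?Q @ [hd ?Q])" using ne' by simp
  qed
qed

text \<open>A nonisolated vertex lies in a positive pair, and its neighbourhood contains the
  co-neighbourhood of that pair, so the co-degree bound covers both kinds of tests.\<close>

lemma typical_V:
  fixes \<epsilon> :: real
  assumes con: "\<And>x y. conbr x y \<noteq> {} \<Longrightarrow> (1 / 2 + \<epsilon>) * card V \<le> card (conbr x y)"
    and iso: "\<And>x. x \<in> V \<Longrightarrow> nbr x \<noteq> {}"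
  shows "typical \<epsilon> V"
  unfolding typical_def
proof
  have sub: "conbr x y \<subseteq> V" for x y using edge_triple(3) by (auto simp: conbr_def)
  fix S assume "S \<in> tests"
  then consider x where "x \<in> V" "S = nbr x" | x y where "S = conbr x y" "conbr x y \<noteq> {}"
    by (auto simp: tests_def)
  then show "(1 / 2 + \<epsilon>) * card V \<le> card (S \<inter> V)"
  proof cases
    case 1
    then obtain y where y: "conbr x y \<noteq> {}" using iso[of x] by (auto simp: nbr_def conbr_def)
    have "conbr x y \<subseteq> S \<inter> V" using sub[of x y] 1 by (auto simp: nbr_def conbr_def insert_commute)
    then have "card (conbr x y) \<le> card (S \<inter> V)" using finite_V by (intro card_mono) auto
    then show ?thesis using con[OF y] by linarith
  next
    case 2
    then show ?thesis using con[of x y] sub[of x y] by (simp add: Int_absorb2)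
  qed
qed

text \<open>Losing \<open>F\<close> leaves every test with density at least
  \<open>1 / 2 + 3 * \<epsilon> / 4\<close>, which exceeds the target
  \<open>1 / 2 + \<epsilon> / 4\<close> by \<open>\<epsilon> / 2\<close>.\<close>

lemma potential_initial:
  fixes \<epsilon> l :: real
  assumes tp: "typical \<epsilon> V" and \<epsilon>: "0 < \<epsilon>" and l: "0 \<le> l" and F: "F \<subseteq> V" "F \<noteq> V" "card F \<le> \<epsilon> / 4 * card V"
  shows "potential l (\<epsilon> / 4) (V - F) \<le> (real (card V) + (real (card V))\<^sup>2) * exp (- (l * \<epsilon> / 2))"
proof -
  define R where "R = V - F"
  have finF: "finite F" using F finite_V finite_subset by blast
  have "R \<noteq> {}" using F by (auto simp: R_def)
  then have R: "0 < card R" "card R \<le> card V"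
    using finite_V by (auto simp: R_def card_gt_0_iff intro: card_mono)
  have "tilt l (\<epsilon> / 4) R S \<le> exp (- (l * \<epsilon> / 2))" if "S \<in> tests" for S
  proof -
    have "(1 / 2 + \<epsilon>) * card V \<le> card (S \<inter> V)" using tp that by (simp add: typical_def)
    moreover have "real (card (S \<inter> V)) - card F \<le> card (S \<inter> R)"
      using card_diff_ge[OF finF, of "S \<inter> V"] by (simp add: R_def Int_Diff)
    moreover have "(1 / 2 + 3 * \<epsilon> / 4) * card R \<le> (1 / 2 + 3 * \<epsilon> / 4) * card V"
      using R \<epsilon> by (intro mult_left_mono) auto
    ultimately have "(1 / 2 + 3 * \<epsilon> / 4) * card R \<le> card (S \<inter> R)"
      using F(3) by (simp add: algebra_simps)
    then have "1 / 2 + \<epsilon> / 4 - card (S \<inter> R) / card R \<le> - (\<epsilon> / 2)"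
      using R(1) by (simp add: field_simps)
    then have "l * (1 / 2 + \<epsilon> / 4 - card (S \<inter> R) / card R) \<le> l * - (\<epsilon> / 2)"
      using l by (intro mult_left_mono) auto
    then show ?thesis by (simp add: tilt_def)
  qed
  then have "potential l (\<epsilon> / 4) R \<le> card tests * exp (- (l * \<epsilon> / 2))"
    unfolding potential_def by (intro sum_bounded_above)
  also have "\<dots> \<le> (real (card V) + (real (card V))\<^sup>2) * exp (- (l * \<epsilon> / 2))"
    using of_nat_mono[OF card_tests, where 'a = real] by (intro mult_right_mono) auto
  finally show ?thesis by (simp add: R_def)
qed

end

text \<open>Here \<open>q\<close> serves both as the number of absorbers per pair and as the number
  of vertices at which the long walk may stop; \<open>k\<close> is the number of lightest vertices,
  and \<open>c * n\<close> is the exponent scale of the potential.\<close>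

lemma hamiltonian_constants:
  fixes \<epsilon> :: real
  assumes "0 < \<epsilon>" "\<epsilon> < 1 / 2"
  obtains K L :: nat and \<delta> c :: real and n0 where "0 < \<delta>" "\<delta> \<le> 1" "4 \<le> \<delta> * L" "0 < c"
    "(1 - \<epsilon>\<^sup>2 / 4) ^ K \<le> 1 / 4"
    "\<And>n. n0 \<le> n \<Longrightarrow> \<exists>q k :: nat. (real n)\<^sup>2 < 2 ^ q \<and> real (6 * (K * q) + 1) \<le> \<epsilon> / 4 * n \<and>
      2 * L + 4 \<le> q \<and> 1 \<le> \<epsilon> / 4 * q \<and> 2 * real L + 4 < 2 * (\<epsilon> / 4) * q \<and>
      c * n * real (2 * L + 4) \<le> \<delta> * q \<and> k < q div 2 \<and> 8 * real (2 * L + 1) < k * (\<epsilon> / 4)\<^sup>2 \<and>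
      2 * real (2 * k + 1) \<le> \<delta> * q \<and> real q \<le> n / 2 \<and> 4 \<le> n \<and>
      (real n + (real n)\<^sup>2) * exp (- (c * n * \<epsilon> / 2)) * exp (2 * (c * n) * \<delta> / q * n) < 1"
proof -
  have "\<epsilon>\<^sup>2 \<le> 1" using assms by (simp add: power_le_one)
  then have "\<bar>1 - \<epsilon>\<^sup>2 / 4\<bar> < 1" using assms by (simp add: abs_less_iff)
  then obtain K where K: "(1 - \<epsilon>\<^sup>2 / 4) ^ K < 1 / 4"
    using real_arch_pow_inv[of "1 / 4" "1 - \<epsilon>\<^sup>2 / 4"] assms(1) by auto
  have K0: "0 < K" using K by (cases K) auto
  \<comment> \<open>With \<open>q\<close> about \<open>\<theta> * n\<close>, the absorbing path
    takes about \<open>6 * K * q \<le> \<epsilon> / 8 * n\<close> vertices.\<close>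
  define \<theta> where "\<theta> = \<epsilon> / (48 * K)"
  have \<theta>: "0 < \<theta>" "\<theta> \<le> 1 / 2"
    using assms K0 by (auto simp: \<theta>_def field_simps)
  \<comment> \<open>As \<open>\<theta> / 2 * n \<le> q\<close>, this gives
    \<open>\<delta> * n / q \<le> \<epsilon> / 16\<close>. The potential then grows by at most
    \<open>exp (c * n * \<epsilon> / 8)\<close>, against an initial factor
    \<open>exp (- (c * n * \<epsilon> / 2))\<close>.\<close>
  define \<delta> where "\<delta> = \<theta> / 2 * \<epsilon> / 16"
  have "\<theta> * \<epsilon> \<le> 1 * 1" using \<theta> assms by (intro mult_mono) auto
  then have \<delta>: "0 < \<delta>" "\<delta> \<le> 1" using \<theta> assms by (auto simp: \<delta>_def)
  define L where "L = nat \<lceil>4 / \<delta>\<rceil>"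
  have "4 / \<delta> \<le> L" unfolding L_def by linarith
  then have L: "4 \<le> \<delta> * L" using \<delta> by (simp add: field_simps)
  define c where "c = \<delta> * (\<theta> / 2) / real (2 * L + 4)"
  have c: "0 < c" using \<delta> \<theta> by (simp add: c_def)
  \<comment> \<open>Bounds are stated for \<open>\<theta> * n - 1\<close>, a lower bound for the
    rounded value \<open>q\<close>.\<close>
  have ev: "eventually (\<lambda>n::nat. C \<le> \<theta> * n - 1) sequentially" for C
    using \<theta> by real_asymp
  have "eventually (\<lambda>n::nat. (real n)\<^sup>2 < 2 powr (\<theta> * n - 1)) sequentially"
    using \<theta> by real_asymp
  moreover have "eventually (\<lambda>n::nat. (real n + (real n)\<^sup>2) * exp (- (c * 3 / 8 * \<epsilon> * n)) < 1) sequentially"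
    using c assms by real_asymp
  moreover have "eventually (\<lambda>n::nat. 8 \<le> \<epsilon> * n) sequentially" using assms by real_asymp
  moreover note ev[of 1] ev[of "2 * real L + 4"] ev[of "4 / \<epsilon>"] ev[of "(2 * real L + 5) * 2 / \<epsilon>"]
    ev[of "4 / \<delta>"] ev[of "(8 * real (2 * L + 2) / (\<epsilon> / 4)\<^sup>2 + 1) * 8 / \<delta>"] ev[of 8]
    eventually_ge_at_top[of 4]
  ultimately have "eventually (\<lambda>n::nat. (real n)\<^sup>2 < 2 powr (\<theta> * n - 1) \<and>
      (real n + (real n)\<^sup>2) * exp (- (c * 3 / 8 * \<epsilon> * n)) < 1 \<and> 8 \<le> \<epsilon> * n \<and>
      1 \<le> \<theta> * n - 1 \<and> 2 * real L + 4 \<le> \<theta> * n - 1 \<and> 4 / \<epsilon> \<le> \<theta> * n - 1 \<and>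
      (2 * real L + 5) * 2 / \<epsilon> \<le> \<theta> * n - 1 \<and> 4 / \<delta> \<le> \<theta> * n - 1 \<and>
      (8 * real (2 * L + 2) / (\<epsilon> / 4)\<^sup>2 + 1) * 8 / \<delta> \<le> \<theta> * n - 1 \<and>
      8 \<le> \<theta> * n - 1 \<and> 4 \<le> n) sequentially"
    by eventually_elim blast
  then obtain n0 where n0: "\<And>n::nat. n0 \<le> n \<Longrightarrow> (real n)\<^sup>2 < 2 powr (\<theta> * n - 1) \<and>
      (real n + (real n)\<^sup>2) * exp (- (c * 3 / 8 * \<epsilon> * n)) < 1 \<and> 8 \<le> \<epsilon> * n \<and>
      1 \<le> \<theta> * n - 1 \<and> 2 * real L + 4 \<le> \<theta> * n - 1 \<and> 4 / \<epsilon> \<le> \<theta> * n - 1 \<and>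
      (2 * real L + 5) * 2 / \<epsilon> \<le> \<theta> * n - 1 \<and> 4 / \<delta> \<le> \<theta> * n - 1 \<and>
      (8 * real (2 * L + 2) / (\<epsilon> / 4)\<^sup>2 + 1) * 8 / \<delta> \<le> \<theta> * n - 1 \<and>
      8 \<le> \<theta> * n - 1 \<and> 4 \<le> n"
    unfolding eventually_sequentially by blast
  show ?thesis
  proof (rule that[OF \<delta>(1,2) L c less_imp_le[OF K], of n0])
    fix n assume "n0 \<le> n"
    note n = n0[OF this]
    define q where "q = nat \<lfloor>\<theta> * n\<rfloor>"
    define k where "k = nat \<lfloor>\<delta> * q / 8\<rfloor>"
    have "0 \<le> \<theta> * n" using \<theta> by simp
    then have q: "\<theta> * n - 1 \<le> q" "q \<le> \<theta> * n" unfolding q_def by linarith+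
    have "0 \<le> \<delta> * q / 8" using \<delta> by simp
    then have k: "\<delta> * q / 8 - 1 \<le> k" "k \<le> \<delta> * q / 8" unfolding k_def by linarith+
    have q_half: "\<theta> / 2 * n \<le> q" using n q by linarith
    have q0: "0 < q" using n q by linarith
    have 1: "(real n)\<^sup>2 < 2 ^ q"
    proof -
      have "2 powr (\<theta> * n - 1) \<le> 2 powr real q" using q by simp
      then show ?thesis using n by (simp add: powr_realpow)
    qed
    have 2: "real (6 * (K * q) + 1) \<le> \<epsilon> / 4 * n"
    proof -
      have "6 * real K * q \<le> 6 * real K * (\<theta> * n)" using q by (intro mult_left_mono) auto
      also have "\<dots> = \<epsilon> / 8 * n" using K0 by (simp add: \<theta>_def)
      finally show ?thesis using n by simp
    qed
    have 3: "2 * L + 4 \<le> q"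
    proof -
      have "2 * real L + 4 \<le> real q" using n q by linarith
      then show ?thesis by linarith
    qed
    have 4: "1 \<le> \<epsilon> / 4 * q"
    proof -
      have "4 / \<epsilon> \<le> q" using n q by linarith
      then show ?thesis using assms by (simp add: field_simps)
    qed
    have 5: "2 * real L + 4 < 2 * (\<epsilon> / 4) * q"
    proof -
      have "(2 * real L + 5) * 2 / \<epsilon> \<le> q" using n q by linarith
      then have "(2 * real L + 5) * 2 \<le> \<epsilon> * q" using assms by (simp add: field_simps)
      then show ?thesis by simp
    qed
    have 6: "c * n * real (2 * L + 4) \<le> \<delta> * q"
    proof -
      have "c * real (2 * L + 4) = \<delta> * (\<theta> / 2)" unfolding c_def by (simp add: field_simps)
      then have "c * n * real (2 * L + 4) = \<delta> * (\<theta> / 2 * n)"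
        by (metis mult.assoc mult.commute)
      also have "\<dots> \<le> \<delta> * q" using q_half \<delta> by (intro mult_left_mono) auto
      finally show ?thesis .
    qed
    have 7: "k < q div 2"
    proof -
      have "8 \<le> real q" using n q by linarith
      moreover have "real k \<le> real q / 8"
        using k(2) \<delta>(2) mult_right_mono[of \<delta> 1 "real q"] by simp
      ultimately show ?thesis by linarith
    qed
    have 8: "8 * real (2 * L + 1) < k * (\<epsilon> / 4)\<^sup>2"
    proof -
      define a where "a = (\<epsilon> / 4)\<^sup>2"
      have a: "0 < a" using assms by (simp add: a_def)
      have "(8 * real (2 * L + 2) / a + 1) * 8 / \<delta> \<le> q" using n q unfolding a_def by linarith
      then have "8 * real (2 * L + 2) / a + 1 \<le> \<delta> * q / 8" using \<delta> by (simp add: field_simps)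
      then have "8 * real (2 * L + 2) / a \<le> k" using k(1) by linarith
      then have "8 * real (2 * L + 2) \<le> k * a" using a by (simp add: field_simps)
      then show ?thesis by (simp add: a_def)
    qed
    have 9: "2 * real (2 * k + 1) \<le> \<delta> * q"
    proof -
      have "4 / \<delta> \<le> q" using n q by linarith
      then have "4 \<le> \<delta> * q" using \<delta> by (simp add: field_simps)
      then show ?thesis using k(2) by simp
    qed
    have 10: "real q \<le> n / 2"
      using q(2) \<theta>(2) mult_right_mono[of \<theta> "1 / 2" "real n"] by simp
    have 11: "(real n + (real n)\<^sup>2) * exp (- (c * n * \<epsilon> / 2)) * exp (2 * (c * n) * \<delta> / q * n) < 1"
    proof -
      have "\<delta> * n = \<epsilon> / 16 * (\<theta> / 2 * n)" by (simp add: \<delta>_def)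
      also have "\<dots> \<le> \<epsilon> / 16 * q" using q_half assms by (intro mult_left_mono) auto
      finally have "\<delta> / q * n \<le> \<epsilon> / 16" using q0 by (simp add: field_simps)
      then have "2 * (c * n) * (\<delta> / q * n) \<le> 2 * (c * n) * (\<epsilon> / 16)" using c by (intro mult_left_mono) auto
      then have "- (c * n * \<epsilon> / 2) + 2 * (c * n) * \<delta> / q * n \<le> - (c * 3 / 8 * \<epsilon> * n)"
        by (simp add: algebra_simps)
      then have "exp (- (c * n * \<epsilon> / 2)) * exp (2 * (c * n) * \<delta> / q * n) \<le> exp (- (c * 3 / 8 * \<epsilon> * n))"
        by (simp add: exp_add[symmetric])
      then have "(real n + (real n)\<^sup>2) * (exp (- (c * n * \<epsilon> / 2)) * exp (2 * (c * n) * \<delta> / q * n)) \<le>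
          (real n + (real n)\<^sup>2) * exp (- (c * 3 / 8 * \<epsilon> * n))"
        by (intro mult_left_mono) auto
      then show ?thesis using n by (simp add: mult.assoc)
    qed
    show "\<exists>q k :: nat. (real n)\<^sup>2 < 2 ^ q \<and> real (6 * (K * q) + 1) \<le> \<epsilon> / 4 * n \<and>
      2 * L + 4 \<le> q \<and> 1 \<le> \<epsilon> / 4 * q \<and> 2 * real L + 4 < 2 * (\<epsilon> / 4) * q \<and>
      c * n * real (2 * L + 4) \<le> \<delta> * q \<and> k < q div 2 \<and> 8 * real (2 * L + 1) < k * (\<epsilon> / 4)\<^sup>2 \<and>
      2 * real (2 * k + 1) \<le> \<delta> * q \<and> real q \<le> n / 2 \<and> 4 \<le> n \<and>
      (real n + (real n)\<^sup>2) * exp (- (c * n * \<epsilon> / 2)) * exp (2 * (c * n) * \<delta> / q * n) < 1"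
      using 1 2 3 4 5 6 7 8 9 10 11 n by blast
  qed
qed

section \<open>Assembling the Hamiltonian cycle\<close>

context finite_three_graph
begin

lemma exists_hamiltonian_walk:
  fixes \<epsilon> \<delta> l :: real
  assumes tp: "typical \<epsilon> V" and \<epsilon>: "0 < \<epsilon>" "\<epsilon> \<le> 1 / 2" and ev: "even (card V)" "4 \<le> card V"
    and K: "(1 - \<epsilon>\<^sup>2 / 4) ^ K \<le> 1 / 4" and q: "(real (card V))\<^sup>2 < 2 ^ q"
      "real (6 * (K * q) + 1) \<le> \<epsilon> / 4 * card V" "2 * L + 4 \<le> q" "real q \<le> card V / 2"
      "1 \<le> \<epsilon> / 4 * q" "2 * real L + 4 < 2 * (\<epsilon> / 4) * q"
    and l: "0 \<le> l" and \<delta>: "0 < \<delta>" "\<delta> \<le> 1" "4 \<le> \<delta> * L" "l * real (2 * L + 4) \<le> \<delta> * q"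
    and k: "k < q div 2" "8 * real (2 * L + 1) < k * (\<epsilon> / 4)\<^sup>2" "2 * real (2 * k + 1) \<le> \<delta> * q"
    and pot: "(real (card V) + (real (card V))\<^sup>2) * exp (- (l * \<epsilon> / 2)) *
      exp (2 * l * \<delta> / q * card V) < 1"
  obtains Q where "distinct Q" "set Q = V" "loose_walk E (Q @ [hd Q])"
proof -
  have V: "V \<noteq> {}" using ev by auto
  have small: "real (6 * (K * q) + 1) \<le> \<epsilon> * card V"
  proof -
    have "\<epsilon> / 4 * card V \<le> \<epsilon> * card V" using \<epsilon> by (intro mult_right_mono) auto
    then show ?thesis using q(2) by linarith
  qed
  obtain P T where P: "loose_walk E P" "distinct P" "set P \<subseteq> V" "length P = 6 * (K * q) + 1"
    and T: "T \<subseteq> set (triples P)"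
    and abs: "\<And>u v. u \<in> V \<Longrightarrow> v \<in> V \<Longrightarrow> q \<le> card {t \<in> T. absorbs E (u, v) t}"
    by (rule absorbing_path[OF tp \<epsilon> V K q(1) small]) blast
  have cP: "card (set P) = 6 * (K * q) + 1" using P(2,4) distinct_card by metis
  have "\<epsilon> / 4 * card V \<le> 1 / 2 * card V" using \<epsilon> by (intro mult_right_mono) auto
  then have cP': "real (card (set P)) \<le> card V / 2" using q(2) cP by simp
  have cR: "card (V - set P) = card V - card (set P)" "card (set P) \<le> card V"
    using P(3) finite_V by (auto simp: card_Diff_subset card_mono)
  have qR: "q \<le> card (V - set P)" using cP' cR q(4) by linarith
  have q0: "0 < q" using q(3) by simp
  have "set P \<noteq> V" using qR q0 by auto
  then have "potential l (\<epsilon> / 4) (V - set P) \<le> (real (card V) + (real (card V))\<^sup>2) * exp (- (l * \<epsilon> / 2))"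
    using q(2) cP by (intro potential_initial[OF tp \<epsilon>(1) l P(3)]) auto
  moreover have "exp (2 * l * \<delta> / q * card (V - set P)) \<le> exp (2 * l * \<delta> / q * card V)"
    using l \<delta>(1) cR by (auto intro!: divide_right_mono mult_left_mono)
  ultimately have "potential l (\<epsilon> / 4) (V - set P) * exp (2 * l * \<delta> / q * card (V - set P)) \<le>
      (real (card V) + (real (card V))\<^sup>2) * exp (- (l * \<epsilon> / 2)) * exp (2 * l * \<delta> / q * card V)"
    by (intro mult_mono) auto
  then have pot': "potential l (\<epsilon> / 4) (V - set P) * exp (2 * l * \<delta> / q * card (V - set P)) < 1"
    using pot by linarith
  have \<epsilon>4: "0 < \<epsilon> / 4" "\<epsilon> / 4 \<le> 1 / 2" using \<epsilon> by auto
  obtain Q where Q: "loose_walk E Q" "distinct Q" "set Q \<subseteq> V" "set (triples P) \<subseteq> set (triples Q)"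
    "typical (\<epsilon> / 4) (V - set Q)" "q \<le> card (V - set Q)" "card (V - set Q) < q + (2 * L + 4)"
    using exists_long_walk[OF \<epsilon>4 q(5,6) l \<delta> k P(1-3) qR pot'] by blast
  have "T \<subseteq> set (triples Q)" using T Q(4) by auto
  moreover have "4 < 2 * (\<epsilon> / 4) * card (V - set Q)"
  proof -
    have "2 * (\<epsilon> / 4) * q \<le> 2 * (\<epsilon> / 4) * card (V - set Q)" using Q(6) \<epsilon> by (intro mult_left_mono) auto
    then show ?thesis using q(6) by linarith
  qed
  \<comment> \<open>Fewer than \<open>q + (2 * L + 4) \<le> 2 * q\<close> vertices remain, so
    \<open>q\<close> absorbers per pair are enough.\<close>
  moreover have "card (V - set Q) \<le> 2 * q + 3" using Q(7) q(3) by linarith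
  ultimately show ?thesis using close_walk[OF Q(1-3) _ abs Q(5) \<epsilon>4 _ _ ev(1)] that by blast
qed

end

text \<open>Each edge through \<open>x, y\<close> is determined by its third vertex, and
  nonemptiness rules out co-degree 0.\<close>

lemma min_pos_codegree_le_card_conbr:
  assumes H: "three_graph H" and ne: "finite_three_graph.conbr (edges H) x y \<noteq> {}"
  shows "min_pos_codegree H \<le> card (finite_three_graph.conbr (edges H) x y)"
proof -
  interpret finite_three_graph "verts H" "edges H"
    using H by unfold_locales (auto simp: three_graph_def)
  obtain z where z: "{x, y, z} \<in> edges H" using ne by (auto simp: conbr_def)
  have xy: "x \<in> verts H" "y \<in> verts H" "x \<noteq> y" using edge_triple[OF z] by auto
  have fin: "finite (conbr x y)"
    using finite_subset[OF _ finite_V, of "conbr x y"] edge_triple(3) by (auto simp: conbr_def)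
  have "{e \<in> edges H. {x, y} \<subseteq> e} \<subseteq> (\<lambda>z. {x, y, z}) ` conbr x y"
  proof
    fix e assume e: "e \<in> {e \<in> edges H. {x, y} \<subseteq> e}"
    then have "card (e - {x, y}) = 1" using edge[of e] xy(3) by (simp add: card_Diff_subset)
    then obtain w where "e - {x, y} = {w}" by (auto simp: card_1_singleton_iff)
    then have "e = {x, y, w}" using e by auto
    then show "e \<in> (\<lambda>z. {x, y, z}) ` conbr x y" using e by (auto simp: conbr_def)
  qed
  then have le: "codegree H {x, y} \<le> card (conbr x y)"
    unfolding codegree_def using fin by (meson card_image_le card_mono finite_imageI order_trans)
  have "finite (edges H)"
    using H by (auto simp: three_graph_def intro: finite_subset[of _ "Pow (verts H)"])
  then have "codegree H {x, y} \<noteq> 0" using z by (auto simp: codegree_def)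
  moreover have "edges H \<noteq> {}" using z by blast
  then have "codegree H {x, y} = 0 \<or> min_pos_codegree H \<le> codegree H {x, y}"
    using le_min_pos_codegree_iff[OF H, of "min_pos_codegree H"] xy by simp
  ultimately show ?thesis using le by linarith
qed

theorem theorem1p9:
  fixes \<epsilon> :: real
  assumes "0 < \<epsilon>" and "\<epsilon> < 1 / 2"
  shows "\<exists>n0 :: nat. \<forall>(n :: nat) (H :: 'a hypergraph).
    three_graph H \<and> card (verts H) = n \<and> (\<forall>v\<in>verts H. \<not> isolated H v) \<and>
    n \<ge> n0 \<and> even n \<and> real (min_pos_codegree H) \<ge> (1 / 2 + \<epsilon>) * real n
    \<longrightarrow> (\<exists>C. loose_hamiltonian_cycle H C)"
proof -
  obtain K L :: nat and \<delta> c :: real and n0 where \<delta>: "0 < \<delta>" "\<delta> \<le> 1" "4 \<le> \<delta> * L" and c: "0 < c"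
    and K: "(1 - \<epsilon>\<^sup>2 / 4) ^ K \<le> 1 / 4"
    and n0: "\<And>n. n0 \<le> n \<Longrightarrow> \<exists>q k :: nat. (real n)\<^sup>2 < 2 ^ q \<and> real (6 * (K * q) + 1) \<le> \<epsilon> / 4 * n \<and>
      2 * L + 4 \<le> q \<and> 1 \<le> \<epsilon> / 4 * q \<and> 2 * real L + 4 < 2 * (\<epsilon> / 4) * q \<and>
      c * n * real (2 * L + 4) \<le> \<delta> * q \<and> k < q div 2 \<and> 8 * real (2 * L + 1) < k * (\<epsilon> / 4)\<^sup>2 \<and>
      2 * real (2 * k + 1) \<le> \<delta> * q \<and> real q \<le> n / 2 \<and> 4 \<le> n \<and>
      (real n + (real n)\<^sup>2) * exp (- (c * n * \<epsilon> / 2)) * exp (2 * (c * n) * \<delta> / q * n) < 1"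
    by (rule hamiltonian_constants[OF assms]) blast
  show ?thesis
  proof (intro exI[of _ n0] allI impI, elim conjE)
    fix n and H :: "'a hypergraph"
    assume H: "three_graph H" and n: "card (verts H) = n" "n0 \<le> n" "even n"
      and iso: "\<forall>v\<in>verts H. \<not> isolated H v"
      and codeg: "(1 / 2 + \<epsilon>) * real n \<le> real (min_pos_codegree H)"
    interpret finite_three_graph "verts H" "edges H"
      using H by unfold_locales (auto simp: three_graph_def)
    have tp: "typical \<epsilon> (verts H)"
    proof (rule typical_V)
      fix x y assume "conbr x y \<noteq> {}"
      then show "(1 / 2 + \<epsilon>) * card (verts H) \<le> card (conbr x y)"
        using min_pos_codegree_le_card_conbr[OF H, of x y] codeg n(1) by simp
    next
      fix x assume x: "x \<in> verts H"
      then obtain e where e: "e \<in> edges H" "x \<in> e" using iso by (auto simp: isolated_def)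
      then have "card (e - {x}) = 2" using edge[of e] by simp
      then obtain y z where "e - {x} = {y, z}" by (auto simp: card_2_iff)
      then have "{x, y, z} \<in> edges H" using e by (metis insert_Diff)
      then show "nbr x \<noteq> {}" by (auto simp: nbr_def)
    qed
    obtain q k where qk: "(real n)\<^sup>2 < 2 ^ q" "real (6 * (K * q) + 1) \<le> \<epsilon> / 4 * n"
      "2 * L + 4 \<le> q" "1 \<le> \<epsilon> / 4 * q" "2 * real L + 4 < 2 * (\<epsilon> / 4) * q"
      "c * n * real (2 * L + 4) \<le> \<delta> * q" "k < q div 2" "8 * real (2 * L + 1) < k * (\<epsilon> / 4)\<^sup>2"
      "2 * real (2 * k + 1) \<le> \<delta> * q" "real q \<le> n / 2" "4 \<le> n"
      "(real n + (real n)\<^sup>2) * exp (- (c * n * \<epsilon> / 2)) * exp (2 * (c * n) * \<delta> / q * n) < 1"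
      using n0[OF n(2)] by blast
    \<comment> \<open>The scale \<open>l = c * n\<close> is linear in \<open>n\<close>, so that the
      exponential beats the polynomial number of tests.\<close>
    obtain Q where Q: "distinct Q" "set Q = verts H" "loose_walk (edges H) (Q @ [hd Q])"
    proof (rule exists_hamiltonian_walk[OF tp assms(1) _ _ _ K, of q L "c * n" \<delta> k])
      show "\<epsilon> \<le> 1 / 2" using assms by simp
      show "0 \<le> c * n" using c by simp
    qed (use qk \<delta> n in simp_all)
    have "length Q = n" using distinct_card[OF Q(1)] Q(2) n(1) by simp
    then obtain m where m: "length Q = 2 * m" using n(3) by blast
    then have "2 \<le> m" using qk(11) \<open>length Q = n\<close> by simp
    then show "\<exists>C. loose_hamiltonian_cycle H C"
      using loose_cycle_of_walk[OF refl _ Q(1) m _ Q(3)] Q(2) by simp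
  qed
qed

end
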